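(* Let $A$ and $B$ be closed and densely defined operators in $\mathcal H$, and assume that either (1) $\operatorname{dom} B=\operatorname{dom} A$ and $B-A$ is $A$-compact, or (2) $\rho(A)\cap\rho(B)\neq\varnothing$ and $(A-\mu)^{-1}-(B-\mu)^{-1}$ is compact for some (and hence for all) $\mu\in\rho(A)\cap\rho(B)$. Then $$\sigma_{\pi_+}(A)\cup \mathrm r(A)=\sigma_{\pi_+}(B)\cup \mathrm r(B),\qquad \sigma_{\pi_-}(A)\cup \mathrm r(A)=\sigma_{\pi_-}(B)\cup \mathrm r(B),$$ and $$\infty\in\sigma_+(A)\iff\infty\in\sigma_+(B),\qquad \infty\in\sigma_-(A)\iff\infty\in\sigma_-(B),\qquad \infty\in\widetilde{\mathrm r}(A)\iff\infty\in\widetilde{\mathrm r}(B).$$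
   Context: $(\mathcal H,(\cdot,\cdot))$ is a Hilbert space, $G$ is a bounded selfadjoint operator in $\mathcal H$ (not assumed boundedly invertible or injective), and $[x,y]:=(Gx,y)$ for $x,y\in\mathcal H$. Let $A$ be a closed, densely defined operator in $\mathcal H$. The approximate point spectrum $\sigma_{ap}(A)$ is the set of all $\lambda\in\mathbb C$ for which there is a sequence $(x_n)$ in $\operatorname{dom}A$ with $\|x_n\|=1$ and $(A-\lambda)x_n\to0$; $\mathrm r(A):=\mathbb C\setminus\sigma_{ap}(A)$. Let $\overline{\mathbb C}=\mathbb C\cup\{\infty\}$; $\widetilde\sigma_{ap}(A):=\sigma_{ap}(A)$ if $A$ is bounded, $\widetilde\sigma_{ap}(A):=\sigma_{ap}(A)\cup\{\infty\}$ if $A$ is unbounded, and $\widetilde{\mathrm r}(A):=\overline{\mathbb C}\setminus\widetilde\sigma_{ap}(A)$. For a linear manifold $\mathcal L\subset\mathcal H$, $\operatorname{codim}\mathcal L:=\dim(\mathcal H/\mathcal L)$. Spectral points of type $\pi_\pm$: a point $\lambda\in\sigma_{ap}(A)$ belongs to $\sigma_{\pi_+}(A)$ (resp. $\sigma_{\pi_-}(A)$) if there is a linear manifold $\mathcal H_\lambda\subset\mathcal H$ with $\operatorname{codim}\mathcal H_\lambda<\infty$ such that for every sequence $(x_n)$ in $\mathcal H_\lambda\cap\operatorname{dom}A$ with $\|x_n\|=1$ and $(A-\lambda)x_n\to0$ one has $\liminf_{n}[x_n,x_n]>0$ (resp. $\limsup_n[x_n,x_n]<0$). The point $\infty$ belongs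 to $\sigma_{\pi_+}(A)$ (resp. $\sigma_{\pi_-}(A)$) if $A$ is unbounded and there is a linear manifold $\mathcal H_\infty\subset\mathcal H$ with $\operatorname{codim}\mathcal H_\infty<\infty$ such that for every sequence $(x_n)$ in $\mathcal H_\infty\cap\operatorname{dom}A$ with $\|Ax_n\|=1$ and $x_n\to0$ one has $\liminf_n[Ax_n,Ax_n]>0$ (resp. $\limsup_n[Ax_n,Ax_n]<0$). The set $\sigma_+(A)$ (resp. $\sigma_-(A)$) consists of all $\lambda\in\sigma_{\pi_+}(A)$ (resp. $\sigma_{\pi_-}(A)$) for which the manifold $\mathcal H_\lambda$ can be chosen as $\mathcal H$. An operator $K$ is called $A$-compact if $\operatorname{dom}A\subset\operatorname{dom}K$ and $K$ is compact as a mapping from $\operatorname{dom}A$, equipped with the graph norm $\|x\|_A=(\|x\|^2+\|Ax\|^2)^{1/2}$, into $\mathcal H$. *)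

theory Defs
  imports "HOL-Analysis.Analysis"
begin

section \<open>Complex Hilbert spaces\<close>

text \<open>
  The real inner product supplied by the library class is the real part of the complex one, so
  norm and completeness are those of the complex Hilbert space. The complex inner product is
  linear in its first argument.
\<close>

class complex_hilbert_space = real_inner + banach +
  fixes scaleC :: "complex \<Rightarrow> 'a \<Rightarrow> 'a" (infixr "*\<^sub>C" 75)
    and cinner :: "'a \<Rightarrow> 'a \<Rightarrow> complex"
  assumes scaleC_add_right: "c *\<^sub>C (x + y) = c *\<^sub>C x + c *\<^sub>C y"
    and scaleC_add_left: "(c + d) *\<^sub>C x = c *\<^sub>C x + d *\<^sub>C x"
    and scaleC_scaleC: "c *\<^sub>C (d *\<^sub>C x) = (c * d) *\<^sub>C x"
    and scaleC_of_real: "complex_of_real r *\<^sub>C x = r *\<^sub>R x"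
    and cinner_add_left: "cinner (x + y) z = cinner x z + cinner y z"
    and cinner_scaleC_left: "cinner (c *\<^sub>C x) y = c * cinner x y"
    and cinner_commute: "cinner x y = cnj (cinner y x)"
    and Re_cinner: "Re (cinner x y) = inner x y"

lemma scaleC_one [simp]: "1 *\<^sub>C x = (x :: 'a::complex_hilbert_space)"
  using scaleC_of_real [of 1 x] by simp

global_interpretation complex_vector:
  vector_space "scaleC :: complex \<Rightarrow> 'a \<Rightarrow> 'a::complex_hilbert_space"
  defines csubspace = complex_vector.subspace
    and cspan = complex_vector.span
  by unfold_locales (simp_all add: scaleC_add_right scaleC_add_left scaleC_scaleC)

text \<open>
  The dimension of the quotient by \<open>L\<close>, as the least number of vectors whose cosets span the
  quotient (\<open>\<infinity>\<close> if no finite set does).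
\<close>

definition codim :: "'a::complex_hilbert_space set \<Rightarrow> enat" where
  "codim L = (INF F \<in> {F. finite F \<and> (\<forall>x. \<exists>s\<in>cspan F. x - s \<in> L)}. enat (card F))"

definition bounded_selfadjoint :: "('a::complex_hilbert_space \<Rightarrow> 'a) \<Rightarrow> bool" where
  "bounded_selfadjoint G \<longleftrightarrow> bounded_linear G \<and> (\<forall>c x. G (c *\<^sub>C x) = c *\<^sub>C G x) \<and>
     (\<forall>x y. cinner (G x) y = cinner x (G y))"


section \<open>Unbounded operators\<close>

text \<open>The values of \<open>app A\<close> outside \<open>odom A\<close> carry no meaning.\<close>

datatype 'a opr = Opr (odom: "'a set") (app: "'a \<Rightarrow> 'a")

definition linear_opr :: "'a::complex_hilbert_space opr \<Rightarrow> bool" where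
  "linear_opr A \<longleftrightarrow> csubspace (odom A) \<and>
     (\<forall>x\<in>odom A. \<forall>y\<in>odom A. app A (x + y) = app A x + app A y) \<and>
     (\<forall>c. \<forall>x\<in>odom A. app A (c *\<^sub>C x) = c *\<^sub>C app A x)"

definition closed_opr :: "'a::complex_hilbert_space opr \<Rightarrow> bool" where
  "closed_opr A \<longleftrightarrow> linear_opr A \<and> closed ((\<lambda>x. (x, app A x)) ` odom A)"

definition densely_defined :: "'a::complex_hilbert_space opr \<Rightarrow> bool" where
  "densely_defined A \<longleftrightarrow> closure (odom A) = UNIV"

definition bounded_opr :: "'a::complex_hilbert_space opr \<Rightarrow> bool" where
  "bounded_opr A \<longleftrightarrow> (\<exists>C. \<forall>x\<in>odom A. norm (app A x) \<le> C * norm x)"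

definition diff_opr :: "'a::complex_hilbert_space opr \<Rightarrow> 'a opr \<Rightarrow> 'a opr" where
  "diff_opr B A = Opr (odom B \<inter> odom A) (\<lambda>x. app B x - app A x)"

definition graph_norm :: "'a::complex_hilbert_space opr \<Rightarrow> 'a \<Rightarrow> real" where
  "graph_norm A x = sqrt ((norm x)\<^sup>2 + (norm (app A x))\<^sup>2)"

definition compact_map ::
  "('a::complex_hilbert_space \<Rightarrow> real) \<Rightarrow> 'a set \<Rightarrow> ('a \<Rightarrow> 'a) \<Rightarrow> bool" where
  "compact_map N V K \<longleftrightarrow>
     (\<forall>S\<subseteq>V. (\<exists>C. \<forall>x\<in>S. N x \<le> C) \<longrightarrow> compact (closure (K ` S)))"

definition relatively_compact ::
  "'a::complex_hilbert_space opr \<Rightarrow> 'a opr \<Rightarrow> bool" where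
  "relatively_compact A K \<longleftrightarrow>
     linear_opr K \<and> odom A \<subseteq> odom K \<and> compact_map (graph_norm A) (odom A) (app K)"

definition resolvent :: "'a::complex_hilbert_space opr \<Rightarrow> complex \<Rightarrow> 'a \<Rightarrow> 'a" where
  "resolvent A \<mu> = inv_into (odom A) (\<lambda>x. app A x - \<mu> *\<^sub>C x)"

definition resolvent_set :: "'a::complex_hilbert_space opr \<Rightarrow> complex set" where
  "resolvent_set A =
     {\<mu>. bij_betw (\<lambda>x. app A x - \<mu> *\<^sub>C x) (odom A) UNIV \<and> bounded_linear (resolvent A \<mu>)}"


section \<open>Approximate point spectrum and spectral points of type \<open>\<pi>\<^sub>+\<close> and \<open>\<pi>\<^sub>-\<close>\<close>

datatype ext_complex = Fin complex | Infty

definition sigma_ap :: "'a::complex_hilbert_space opr \<Rightarrow> complex set" where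
  "sigma_ap A = {z. \<exists>x. (\<forall>n. x n \<in> odom A \<and> norm (x n) = 1) \<and>
                      (\<lambda>n. app A (x n) - z *\<^sub>C x n) \<longlonglongrightarrow> 0}"

definition reg_ap :: "'a::complex_hilbert_space opr \<Rightarrow> complex set" where
  "reg_ap A = - sigma_ap A"

definition sigma_ap_ext :: "'a::complex_hilbert_space opr \<Rightarrow> ext_complex set" where
  "sigma_ap_ext A = (if bounded_opr A then Fin ` sigma_ap A else Fin ` sigma_ap A \<union> {Infty})"

definition reg_ap_ext :: "'a::complex_hilbert_space opr \<Rightarrow> ext_complex set" where
  "reg_ap_ext A = - sigma_ap_ext A"

text \<open>
  The form \<open>[x,y] = (Gx,y)\<close>. The values \<open>[x,x]\<close> are real for selfadjoint \<open>G\<close>, which is why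
  only their real part is used below.
\<close>

definition gform :: "('a::complex_hilbert_space \<Rightarrow> 'a) \<Rightarrow> 'a \<Rightarrow> 'a \<Rightarrow> complex" where
  "gform G x y = cinner (G x) y"

text \<open>The sequence condition at a point of the extended plane, for a prescribed manifold \<open>L\<close>.\<close>

fun positive_on ::
  "('a::complex_hilbert_space \<Rightarrow> 'a) \<Rightarrow> 'a opr \<Rightarrow> ext_complex \<Rightarrow> 'a set \<Rightarrow> bool" where
  "positive_on G A (Fin z) L \<longleftrightarrow>
     (\<forall>x. (\<forall>n. x n \<in> L \<inter> odom A \<and> norm (x n) = 1) \<and>
          (\<lambda>n. app A (x n) - z *\<^sub>C x n) \<longlonglongrightarrow> 0 \<longrightarrow>
          liminf (\<lambda>n. ereal (Re (gform G (x n) (x n)))) > 0)"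
| "positive_on G A Infty L \<longleftrightarrow>
     (\<forall>x. (\<forall>n. x n \<in> L \<inter> odom A \<and> norm (app A (x n)) = 1) \<and> x \<longlonglongrightarrow> 0 \<longrightarrow>
          liminf (\<lambda>n. ereal (Re (gform G (app A (x n)) (app A (x n))))) > 0)"

fun negative_on ::
  "('a::complex_hilbert_space \<Rightarrow> 'a) \<Rightarrow> 'a opr \<Rightarrow> ext_complex \<Rightarrow> 'a set \<Rightarrow> bool" where
  "negative_on G A (Fin z) L \<longleftrightarrow>
     (\<forall>x. (\<forall>n. x n \<in> L \<inter> odom A \<and> norm (x n) = 1) \<and>
          (\<lambda>n. app A (x n) - z *\<^sub>C x n) \<longlonglongrightarrow> 0 \<longrightarrow>
          limsup (\<lambda>n. ereal (Re (gform G (x n) (x n)))) < 0)"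
| "negative_on G A Infty L \<longleftrightarrow>
     (\<forall>x. (\<forall>n. x n \<in> L \<inter> odom A \<and> norm (app A (x n)) = 1) \<and> x \<longlonglongrightarrow> 0 \<longrightarrow>
          limsup (\<lambda>n. ereal (Re (gform G (app A (x n)) (app A (x n))))) < 0)"

text \<open>Membership in \<open>sigma_ap_ext A\<close> means, for \<open>Infty\<close>, that \<open>A\<close> is unbounded.\<close>

definition sigma_pi_plus ::
  "('a::complex_hilbert_space \<Rightarrow> 'a) \<Rightarrow> 'a opr \<Rightarrow> ext_complex set" where
  "sigma_pi_plus G A = {z \<in> sigma_ap_ext A. \<exists>L. csubspace L \<and> codim L < \<infinity> \<and> positive_on G A z L}"

definition sigma_pi_minus ::
  "('a::complex_hilbert_space \<Rightarrow> 'a) \<Rightarrow> 'a opr \<Rightarrow> ext_complex set" where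
  "sigma_pi_minus G A = {z \<in> sigma_ap_ext A. \<exists>L. csubspace L \<and> codim L < \<infinity> \<and> negative_on G A z L}"

definition sigma_plus ::
  "('a::complex_hilbert_space \<Rightarrow> 'a) \<Rightarrow> 'a opr \<Rightarrow> ext_complex set" where
  "sigma_plus G A = {z \<in> sigma_pi_plus G A. positive_on G A z UNIV}"

definition sigma_minus ::
  "('a::complex_hilbert_space \<Rightarrow> 'a) \<Rightarrow> 'a opr \<Rightarrow> ext_complex set" where
  "sigma_minus G A = {z \<in> sigma_pi_minus G A. negative_on G A z UNIV}"

end

theory Submission
  imports Defs "HOL-Real_Asymp.Real_Asymp"
begin

text \<open>
  A point \<open>\<lambda>\<close> lies in the union of the spectrum of type \<open>\<pi>\<^sub>+\<close> and the regular set exactly when the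
  sequence condition holds on some manifold of finite codimension, which need not be closed. A
  compact map is uniformly small on the annihilator of a finite net of its image of the unit ball,
  so \<open>A\<close> and \<open>B\<close>, after identifying their domains linearly, differ by an arbitrarily small multiple
  of the graph norm on manifolds of finite codimension; this carries the condition at \<open>\<lambda>\<close> from
  \<open>A\<close> to \<open>B\<close>. At \<open>\<infinity>\<close> no loss of dimension is allowed. There closedness is used: if \<open>x\<^sub>n \<rightarrow> 0\<close> with
  \<open>A x\<^sub>n\<close> bounded, convex combinations of tails make \<open>A x\<^sub>n\<close> converge in norm, necessarily to \<open>0\<close>, which
  shows that the perturbation has relative bound zero.
\<close>

subsection \<open>Complex linearity\<close>

lemma cinner_self: "cinner x x = complex_of_real ((norm (x :: 'a::complex_hilbert_space))\<^sup>2)"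
proof -
  have "cnj (cinner x x) = cinner x x"
    using cinner_commute [of x x] by simp
  then have "Im (cinner x x) = 0"
    by (metis Reals_cnj_iff complex_is_Real_iff)
  then show ?thesis
    by (simp add: complex_eq_iff Re_cinner power2_norm_eq_inner)
qed

lemma norm_scaleC: "norm (c *\<^sub>C x) = cmod c * norm (x :: 'a::complex_hilbert_space)"
proof -
  have "cinner (c *\<^sub>C x) (c *\<^sub>C x) = c * cnj (c * cinner x x)"
    by (metis cinner_commute cinner_scaleC_left)
  also have "\<dots> = complex_of_real ((cmod c * norm x)\<^sup>2)"
    using complex_norm_square [of c] by (simp add: cinner_self power_mult_distrib mult_ac)
  finally have "(norm (c *\<^sub>C x))\<^sup>2 = (cmod c * norm x)\<^sup>2"
    by (metis cinner_self of_real_eq_iff)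
  then show ?thesis
    by (simp add: power2_eq_iff_nonneg)
qed

lemma scaleC_minus1: "(- 1) *\<^sub>C x = - (x :: 'a::complex_hilbert_space)"
  using scaleC_of_real [of "-1" x] by simp

lemma scaleC_scaleR: "c *\<^sub>C (r *\<^sub>R x) = r *\<^sub>R (c *\<^sub>C (x :: 'a::complex_hilbert_space))"
  by (simp flip: scaleC_of_real add: scaleC_scaleC mult.commute)

lemma bounded_linear_scaleC: "bounded_linear ((*\<^sub>C) c :: 'a::complex_hilbert_space \<Rightarrow> 'a)"
  by (rule bounded_linear_intro [of _ "cmod c"])
    (simp_all add: scaleC_add_right scaleC_scaleR norm_scaleC mult.commute)

lemma csubspace_scaleR:
  "csubspace L \<Longrightarrow> x \<in> L \<Longrightarrow> r *\<^sub>R x \<in> (L :: 'a::complex_hilbert_space set)"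
  by (metis complex_vector.subspace_scale scaleC_of_real)

text \<open>Linearity with the manifold as an argument, so that operators, their differences,
  resolvents and the comparison maps \<open>T\<close> are all treated alike.\<close>

definition clinear_on :: "'a::complex_hilbert_space set \<Rightarrow> ('a \<Rightarrow> 'a) \<Rightarrow> bool" where
  "clinear_on W f \<longleftrightarrow> csubspace W \<and> (\<forall>x\<in>W. \<forall>y\<in>W. f (x + y) = f x + f y) \<and>
     (\<forall>c. \<forall>x\<in>W. f (c *\<^sub>C x) = c *\<^sub>C f x)"

lemma clinear_onD:
  assumes "clinear_on W f"
  shows "csubspace W"
    and "x \<in> W \<Longrightarrow> y \<in> W \<Longrightarrow> f (x + y) = f x + f y"
    and "x \<in> W \<Longrightarrow> f (c *\<^sub>C x) = c *\<^sub>C f x"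
    and "x \<in> W \<Longrightarrow> f (r *\<^sub>R x) = r *\<^sub>R f x"
    and "f 0 = 0"
    and "x \<in> W \<Longrightarrow> y \<in> W \<Longrightarrow> f (x - y) = f x - f y"
proof -
  show s: "csubspace W"
    and a: "\<And>x y. x \<in> W \<Longrightarrow> y \<in> W \<Longrightarrow> f (x + y) = f x + f y"
    and h: "\<And>x c. x \<in> W \<Longrightarrow> f (c *\<^sub>C x) = c *\<^sub>C f x"
    using assms by (auto simp: clinear_on_def)
  show "x \<in> W \<Longrightarrow> f (r *\<^sub>R x) = r *\<^sub>R f x" for x r
    using h [of x "complex_of_real r"] by (simp add: scaleC_of_real)
  show "f 0 = 0"
    using h [OF complex_vector.subspace_0 [OF s], of 0] by simp
  show "x \<in> W \<Longrightarrow> y \<in> W \<Longrightarrow> f (x - y) = f x - f y"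
    using a [of x "(-1) *\<^sub>C y"] h [of y "-1"] complex_vector.subspace_scale [OF s, of y "-1"]
    by (simp add: scaleC_minus1)
qed

lemma linear_opr_clinear_on: "linear_opr A \<longleftrightarrow> clinear_on (odom A) (app A)"
  by (simp add: linear_opr_def clinear_on_def)

subsection \<open>Manifolds of finite codimension\<close>

definition fincodim :: "'a::complex_hilbert_space set \<Rightarrow> bool" where
  "fincodim L \<longleftrightarrow> csubspace L \<and> codim L < \<infinity>"

text \<open>The infimum of the empty set in \<open>enat\<close> is infinite and every candidate
  \<open>enat (card F)\<close> is finite, so finite codimension amounts to the existence of one
  finite set.\<close>

lemma fincodim_iff:
  "fincodim L \<longleftrightarrow> csubspace L \<and> (\<exists>F. finite F \<and> (\<forall>x. \<exists>s\<in>cspan F. x - s \<in> L))"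
proof -
  have "codim L < \<infinity> \<longleftrightarrow> {F. finite F \<and> (\<forall>x. \<exists>s\<in>cspan F. x - s \<in> L)} \<noteq> {}"
    unfolding codim_def INF_less_iff by auto
  then show ?thesis
    by (auto simp: fincodim_def)
qed

lemma fincodim_UNIV: "fincodim UNIV"
  unfolding fincodim_iff
  by (auto intro!: exI [of _ "{}"] complex_vector.subspace_UNIV)

text \<open>The coset spanning sets are pulled back one vector at a time: adding \<open>v\<close> to \<open>L\<close>
  enlarges the preimage by at most one dimension.\<close>

lemma finite_cosets_preimage:
  assumes "clinear_on W g" "finite F" "csubspace L"
    and "\<And>x. x \<in> W \<Longrightarrow> \<exists>s\<in>cspan F. g x - s \<in> L"
  shows "\<exists>F'. finite F' \<and> (\<forall>x\<in>W. \<exists>s\<in>cspan F'. x - s \<in> W \<and> g (x - s) \<in> L)"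
  using assms(2-)
proof (induction F arbitrary: L rule: finite_induct)
  case empty
  then have "\<forall>x\<in>W. \<exists>s\<in>cspan {}. x - s \<in> W \<and> g (x - s) \<in> L"
    by simp
  then show ?case by (intro exI [of _ "{}"]) simp
next
  case (insert v F)
  note W = clinear_onD [OF assms(1)] and L = insert.prems(1)
  \<comment> \<open>\<open>v\<close> is moved from the spanning set into the manifold: modulo
    \<open>L1\<close> the values of \<open>g\<close> are spanned by \<open>F\<close> alone, as the
    induction hypothesis requires.\<close>
  define L1 where "L1 = {l + c *\<^sub>C v |l c. l \<in> L}"
  have L1: "csubspace L1"
    unfolding complex_vector.subspace_def
  proof (intro conjI ballI allI)
    show "0 \<in> L1"
      using complex_vector.subspace_0 [OF L] unfolding L1_def
      by (auto intro!: exI [of _ 0])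
  next
    fix x y assume "x \<in> L1" "y \<in> L1"
    then obtain l c m d where *: "l \<in> L" "m \<in> L" "x = l + c *\<^sub>C v" "y = m + d *\<^sub>C v"
      unfolding L1_def by auto
    then have "x + y = (l + m) + (c + d) *\<^sub>C v"
      by (simp add: scaleC_add_left)
    then show "x + y \<in> L1"
      unfolding L1_def using complex_vector.subspace_add [OF L *(1,2)] by blast
  next
    fix a x assume "x \<in> L1"
    then obtain l c where *: "l \<in> L" "x = l + c *\<^sub>C v"
      unfolding L1_def by auto
    then have "a *\<^sub>C x = a *\<^sub>C l + (a * c) *\<^sub>C v"
      by (simp add: scaleC_add_right scaleC_scaleC)
    then show "a *\<^sub>C x \<in> L1"
      unfolding L1_def using complex_vector.subspace_scale [OF L *(1)] by blast
  qed
  have "\<exists>s\<in>cspan F. g x - s \<in> L1" if x: "x \<in> W" for x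
  proof -
    obtain s where s: "s \<in> cspan (insert v F)" "g x - s \<in> L"
      using insert.prems(2) [OF x] by blast
    then obtain c where c: "s - c *\<^sub>C v \<in> cspan F"
      by (auto simp: complex_vector.span_insert)
    have "g x - (s - c *\<^sub>C v) = (g x - s) + c *\<^sub>C v" by simp
    with s(2) have "g x - (s - c *\<^sub>C v) \<in> L1"
      unfolding L1_def by blast
    with c show ?thesis by blast
  qed
  from insert.IH [OF L1 this] obtain F1
    where F1: "finite F1" "\<And>x. x \<in> W \<Longrightarrow> \<exists>s\<in>cspan F1. x - s \<in> W \<and> g (x - s) \<in> L1"
    by blast
  \<comment> \<open>If \<open>L1\<close> and \<open>L\<close> have the same preimage,
    \<open>F1\<close> already suffices. Otherwise a single \<open>x0\<close> from the difference is
    added; its coefficient \<open>c0\<close> is nonzero because \<open>g x0\<close> lies outside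
    \<open>L\<close>.\<close>
  show ?case
  proof (cases "\<exists>x0\<in>W. g x0 \<in> L1 \<and> g x0 \<notin> L")
    case False
    with F1 show ?thesis by blast
  next
    case True
    then obtain x0 l0 c0 where x0: "x0 \<in> W" "g x0 = l0 + c0 *\<^sub>C v" "l0 \<in> L" "g x0 \<notin> L"
      unfolding L1_def by blast
    then have c0: "c0 \<noteq> 0" by auto
    have "\<exists>s\<in>cspan (insert x0 F1). x - s \<in> W \<and> g (x - s) \<in> L" if x: "x \<in> W" for x
    proof -
      obtain s where s: "s \<in> cspan F1" "x - s \<in> W" "g (x - s) \<in> L1"
        using F1(2) [OF x] by blast
      then obtain l c where l: "g (x - s) = l + c *\<^sub>C v" "l \<in> L"
        unfolding L1_def by blast
      \<comment> \<open>The coefficient cancels the \<open>v\<close>-component \<open>c\<close> of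
        \<open>g (x - s)\<close>.\<close>
      define t where "t = s + (c / c0) *\<^sub>C x0"
      have "t \<in> cspan (insert x0 F1)"
        unfolding t_def complex_vector.span_insert using s(1) by (auto intro!: exI [of _ "c / c0"])
      moreover have xt: "x - t = (x - s) - (c / c0) *\<^sub>C x0"
        by (simp add: t_def)
      moreover have x0': "(c / c0) *\<^sub>C x0 \<in> W"
        using complex_vector.subspace_scale [OF W(1) x0(1)] .
      moreover have "g (x - t) = l - (c / c0) *\<^sub>C l0"
        unfolding xt W(6) [OF s(2) x0'] W(3) [OF x0(1)] l(1) x0(2)
        using c0 by (simp add: scaleC_add_right scaleC_scaleC)
      ultimately show ?thesis
        using complex_vector.subspace_diff [OF W(1) s(2) x0']
          complex_vector.subspace_diff [OF L l(2) complex_vector.subspace_scale [OF L x0(3)]]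
        by metis
    qed
    with F1(1) show ?thesis
      by (intro exI [of _ "insert x0 F1"]) simp
  qed
qed

lemma fincodim_vimage:
  assumes g: "clinear_on UNIV g" and L: "fincodim L"
  shows "fincodim (g -` L)"
proof -
  obtain F where F: "csubspace L" "finite F" "\<And>x. \<exists>s\<in>cspan F. x - s \<in> L"
    using L by (auto simp: fincodim_iff)
  have "\<exists>F'. finite F' \<and> (\<forall>x\<in>UNIV. \<exists>s\<in>cspan F'. x - s \<in> UNIV \<and> g (x - s) \<in> L)"
    using finite_cosets_preimage [OF g F(2,1)] F(3) by blast
  moreover have "csubspace (g -` L)"
    using clinear_onD [OF g] F(1) by (auto simp: complex_vector.subspace_def)
  ultimately show ?thesis
    by (auto simp: fincodim_iff)
qed

text \<open>Reduce modulo \<open>L\<close> first; the remainder lies in \<open>L\<close>, and the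
  inclusion of \<open>L\<close> into the space pulls the cosets of \<open>M\<close> back to
  \<open>L\<close>.\<close>

lemma fincodim_Int:
  assumes L: "fincodim L" and M: "fincodim M"
  shows "fincodim (L \<inter> M)"
proof -
  obtain F where F: "csubspace L" "finite F" "\<And>x. \<exists>s\<in>cspan F. x - s \<in> L"
    using L by (auto simp: fincodim_iff)
  obtain E where E: "csubspace M" "finite E" "\<And>x. \<exists>s\<in>cspan E. x - s \<in> M"
    using M by (auto simp: fincodim_iff)
  have "clinear_on L (\<lambda>x. x)"
    using F(1) by (simp add: clinear_on_def)
  from finite_cosets_preimage [OF this E(2,1)] E(3) obtain F'
    where F': "finite F'" "\<And>x. x \<in> L \<Longrightarrow> \<exists>s\<in>cspan F'. x - s \<in> L \<and> x - s \<in> M"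
    by blast
  have "\<exists>s\<in>cspan (F \<union> F'). x - s \<in> L \<inter> M" for x
  proof -
    obtain s where s: "s \<in> cspan F" "x - s \<in> L" using F(3) by blast
    obtain t where t: "t \<in> cspan F'" "x - s - t \<in> L" "x - s - t \<in> M" using F'(2) [OF s(2)] by blast
    have "s + t \<in> cspan (F \<union> F')"
      unfolding complex_vector.span_Un using s(1) t(1) by blast
    with t show ?thesis
      by (metis IntI diff_diff_add)
  qed
  then show ?thesis
    unfolding fincodim_iff
    using F(1,2) E(1) F'(1) complex_vector.subspace_inter finite_UnI by blast
qed

lemma fincodim_kernel: "fincodim {x. cinner x y = 0}"
proof -
  have "csubspace {x. cinner x y = 0}"
    using cinner_scaleC_left [of 0 0 y]
    by (simp add: complex_vector.subspace_def cinner_add_left cinner_scaleC_left)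
  moreover have "\<exists>s\<in>cspan {y}. x - s \<in> {x. cinner x y = 0}" for x
  proof -
    \<comment> \<open>For y = 0 the projection coefficient is a division by zero with value 0, so
      the functional itself has to vanish.\<close>
    have "cinner x y = 0" if "cinner y y = 0"
    proof -
      from that have "y = 0" by (simp add: cinner_self)
      then have "cinner y x = 0"
        using cinner_scaleC_left [of 0 0 x] by simp
      then show ?thesis using cinner_commute [of x y] by simp
    qed
    then have "cinner (x - (cinner x y / cinner y y) *\<^sub>C y) y = 0"
      using cinner_add_left [of "x - (cinner x y / cinner y y) *\<^sub>C y" "(cinner x y / cinner y y) *\<^sub>C y" y]
      by (cases "cinner y y = 0") (simp_all add: cinner_scaleC_left)
    moreover have "(cinner x y / cinner y y) *\<^sub>C y \<in> cspan {y}"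
      by (intro complex_vector.span_scale complex_vector.span_base) simp
    ultimately show ?thesis by blast
  qed
  ultimately show ?thesis
    unfolding fincodim_iff by (intro conjI exI [of _ "{y}"]) auto
qed

lemma fincodim_annihilator: "finite Y \<Longrightarrow> fincodim {x. \<forall>y\<in>Y. cinner x y = 0}"
proof (induction Y rule: finite_induct)
  case empty
  then show ?case by (simp add: fincodim_UNIV)
next
  case (insert y Y)
  have "{x. \<forall>z\<in>insert y Y. cinner x z = 0} = {x. cinner x y = 0} \<inter> {x. \<forall>y\<in>Y. cinner x y = 0}"
    by auto
  then show ?case using fincodim_Int [OF fincodim_kernel insert.IH] by simp
qed

interpretation complex_vector_pair:
  vector_space_pair "scaleC :: complex \<Rightarrow> 'a \<Rightarrow> 'a::complex_hilbert_space"
    "scaleC :: complex \<Rightarrow> 'a \<Rightarrow> 'a"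
  by unfold_locales

text \<open>An algebraic projection onto \<open>W\<close> extends \<open>g\<close> to the whole space.\<close>

lemma fincodim_pullback:
  assumes g: "clinear_on W g" and L: "fincodim L"
  obtains L' where "fincodim L'" "\<And>x. x \<in> L' \<inter> W \<Longrightarrow> g x \<in> L"
proof -
  note W = clinear_onD [OF g]
  obtain B where B: "B \<subseteq> W" "complex_vector.independent B" "W \<subseteq> cspan B"
    using complex_vector.maximal_independent_subset [of W] by blast
  have span: "cspan B = W"
    using B W(1) complex_vector.span_minimal by blast
  \<comment> \<open>\<open>construct\<close> fixes \<open>B\<close> and sends the other vectors of
    an extended basis to 0, so \<open>P\<close> is a projection onto \<open>W\<close>. It may be
    discontinuous, but \<open>fincodim\<close> is purely algebraic.\<close>
  define P where "P = complex_vector_pair.construct B (\<lambda>x. x)"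
  have lin: "Vector_Spaces.linear (*\<^sub>C) (*\<^sub>C) P"
    unfolding P_def by (rule complex_vector_pair.linear_construct [OF B(2)])
  have PW: "P x \<in> W" for x
    using complex_vector_pair.construct_in_span [OF B(2), of "\<lambda>x. x" x] span by (simp add: P_def)
  interpret P: Vector_Spaces.linear "(*\<^sub>C)" "(*\<^sub>C)" P by (rule lin)
  have Pid: "P x = x" if "x \<in> W" for x
  proof -
    have "P b = b" if "b \<in> B" for b
      unfolding P_def by (rule complex_vector_pair.construct_basis [OF B(2) that])
    then show ?thesis
      using complex_vector_pair.linear_eq_on_span [OF lin complex_vector.linear_id, of B x] that span
      by (simp add: id_def)
  qed
  have "clinear_on UNIV (\<lambda>x. g (P x))"
    using W PW by (simp add: clinear_on_def P.add P.scale complex_vector.subspace_UNIV)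
  from fincodim_vimage [OF this L] show ?thesis
    by (rule that) (auto simp: Pid)
qed

text \<open>On \<open>L\<close> the vector \<open>K x\<close> is orthogonal to a finite
  \<open>\<eta>\<close>-net \<open>Y\<close> of the image of the unit ball of \<open>N\<close>. By
  Pythagoras the distance from an image vector to a net point is then at least its norm, which is
  therefore below \<open>\<eta>\<close>. The gauge \<open>N\<close> stands for the norm or for a
  graph norm.\<close>

lemma fincodim_small:
  fixes W :: "'a::complex_hilbert_space set"
  assumes K: "clinear_on W K" and cpt: "compact_map N W K"
    and N: "\<And>r x. r > 0 \<Longrightarrow> x \<in> W \<Longrightarrow> N (r *\<^sub>R x) = r * N x"
      "\<And>x. x \<in> W \<Longrightarrow> x \<noteq> 0 \<Longrightarrow> N x > 0"
    and \<eta>: "\<eta> > 0"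
  obtains L where "fincodim L" "\<And>x. x \<in> L \<inter> W \<Longrightarrow> norm (K x) \<le> \<eta> * N x"
proof -
  note W = clinear_onD [OF K]
  define S where "S = {x\<in>W. N x \<le> 1}"
  have "compact (closure (K ` S))"
    using cpt [unfolded compact_map_def, rule_format, of S] by (auto simp: S_def)
  then obtain Y where Y: "finite Y" "closure (K ` S) \<subseteq> (\<Union>y\<in>Y. ball y \<eta>)"
    using \<eta> by (metis compact_eq_totally_bounded)
  obtain L where L: "fincodim L" "\<And>x. x \<in> L \<inter> W \<Longrightarrow> K x \<in> {z. \<forall>y\<in>Y. cinner z y = 0}"
    using fincodim_pullback [OF K fincodim_annihilator [OF Y(1)]] by blast
  have "norm (K x) \<le> \<eta> * N x" if x: "x \<in> L \<inter> W" for x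
  proof (cases "x = 0")
    case True
    \<comment> \<open>Homogeneity is assumed for positive factors only; the factor 2 forces the
      value at 0.\<close>
    have "N 0 = 0"
      using N(1) [of 2 0] W(1) complex_vector.subspace_0 by fastforce
    with True show ?thesis by (simp add: W(5))
  next
    case False
    define r where "r = inverse (N x)"
    have Nx: "N x > 0" using N(2) x False by blast
    then have r: "r > 0" by (simp add: r_def)
    have "r *\<^sub>R x \<in> S"
      using x r Nx N(1) [of r x] csubspace_scaleR [OF W(1)] by (auto simp: S_def r_def)
    then have "K (r *\<^sub>R x) \<in> closure (K ` S)"
      by (intro subsetD [OF closure_subset] imageI)
    then have "K (r *\<^sub>R x) \<in> (\<Union>y\<in>Y. ball y \<eta>)"
      by (rule subsetD [OF Y(2)])
    then obtain y where y: "y \<in> Y" "norm (K (r *\<^sub>R x) - y) < \<eta>"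
      by (auto simp: dist_norm norm_minus_commute)
    have "cinner (K x) y = 0" using L(2) [OF x] y(1) by blast
    then have "inner (K x) y = 0" using Re_cinner [of "K x" y] by simp
    then have "inner (K (r *\<^sub>R x)) y = 0" using W(4) x by simp
    then have "(norm (K (r *\<^sub>R x)))\<^sup>2 \<le> (norm (K (r *\<^sub>R x) - y))\<^sup>2"
      by (simp add: power2_norm_eq_inner inner_diff_left inner_diff_right inner_commute)
    then have "norm (K (r *\<^sub>R x)) < \<eta>"
      using y(2) by (simp add: power2_le_iff_abs_le)
    then show ?thesis
      using x r Nx W(4) by (simp add: r_def field_simps)
  qed
  with L(1) show ?thesis using that by blast
qed

subsection \<open>Relative bound zero\<close>

text \<open>Mazur's lemma for the tails of a bounded sequence: near-minimal vectors of the decreasing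
  convex hulls form a Cauchy sequence by the parallelogram law.\<close>

lemma convergent_tail_convex_combinations:
  fixes a :: "nat \<Rightarrow> 'b::{real_inner, complete_space}"
  assumes "bounded (range a)"
  obtains q l where "\<And>n. q n \<in> convex hull (a ` {n..})" "q \<longlonglongrightarrow> l"
proof -
  define H where "H n = convex hull (a ` {n..})" for n
  define d where "d n = Inf (norm ` H n)" for n
  obtain M where M: "\<And>n. norm (a n) \<le> M"
    using assms by (auto simp: bounded_iff)
  have H: "a n \<in> H n" for n
    unfolding H_def by (rule hull_inc) auto
  have bdd: "bdd_below (norm ` H n)" for n
    by (rule bdd_belowI2 [of _ 0]) simp
  have H_anti: "H n \<subseteq> H m" if "m \<le> n" for m n
    unfolding H_def using that by (intro hull_mono image_mono) auto
  have "incseq d"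
    unfolding d_def mono_def
    using H by (intro allI impI cInf_superset_mono image_mono H_anti bdd) blast+
  moreover have "d n \<le> M" for n
    unfolding d_def using H M bdd by (meson cINF_lower order_trans)
  ultimately obtain D where D: "d \<longlonglongrightarrow> D"
    using incseq_convergent by blast
  have "\<exists>x\<in>H n. norm x < d n + 1 / Suc n" for n
    using cInf_lessD [of "norm ` H n" "d n + 1 / Suc n"] H [of n]
    by (auto simp: d_def)
  then obtain q where q: "\<And>n. q n \<in> H n" "\<And>n. norm (q n) < d n + 1 / Suc n"
    by metis
  have dH: "d n \<le> norm x" if "x \<in> H n" for n x
    unfolding d_def using that bdd by (intro cINF_lower)
  have "(\<lambda>n. d n + 1 / Suc n) \<longlonglongrightarrow> D + 0"
    by (intro tendsto_add D) real_asymp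
  then have up: "(\<lambda>n. d n + 1 / Suc n) \<longlonglongrightarrow> D" by simp
  have "(\<lambda>n. norm (q n)) \<longlonglongrightarrow> D"
    by (rule real_tendsto_sandwich [OF _ _ D up])
      (use q(2) dH [OF q(1)] in \<open>auto simp: less_imp_le\<close>)
  then have lim: "(\<lambda>n. (norm (q n))\<^sup>2) \<longlonglongrightarrow> D\<^sup>2" "(\<lambda>n. (d n)\<^sup>2) \<longlonglongrightarrow> D\<^sup>2"
    using D by (auto intro: tendsto_power)
  \<comment> \<open>The midpoint of \<open>q m\<close> and \<open>q n\<close> stays in the larger
    hull \<open>H m\<close>, so its norm is at least \<open>d m\<close>; the parallelogram law turns
    this into a bound for the difference.\<close>
  have par: "(norm (q m - q n))\<^sup>2 \<le> 2 * (norm (q m))\<^sup>2 + 2 * (norm (q n))\<^sup>2 - 4 * (d m)\<^sup>2"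
    if "m \<le> n" for m n
  proof -
    have "(1 / 2) *\<^sub>R q m + (1 / 2) *\<^sub>R q n \<in> H m"
      using q(1) H_anti [OF that] convex_convex_hull [of "a ` {m..}"]
      by (intro convexD) (auto simp: H_def)
    then have "d m \<le> norm ((1 / 2) *\<^sub>R (q m + q n))"
      using dH by (simp add: scaleR_add_right)
    then have "2 * d m \<le> norm (q m + q n)" by simp
    moreover have "0 \<le> d m"
      unfolding d_def using H by (intro cINF_greatest) auto
    ultimately have "(2 * d m)\<^sup>2 \<le> (norm (q m + q n))\<^sup>2"
      by (intro power_mono) auto
    then show ?thesis
      by (simp add: power2_norm_eq_inner inner_add_left inner_add_right inner_diff_left
          inner_diff_right inner_commute)
  qed
  have "Cauchy q"
  proof (rule CauchyI')
    fix e :: real assume e: "e > 0"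
    have "\<forall>\<^sub>F n in sequentially. \<bar>(norm (q n))\<^sup>2 - D\<^sup>2\<bar> < e\<^sup>2 / 16 \<and> \<bar>(d n)\<^sup>2 - D\<^sup>2\<bar> < e\<^sup>2 / 16"
      using tendstoD [OF lim(1), of "e\<^sup>2 / 16"] tendstoD [OF lim(2), of "e\<^sup>2 / 16"] e
      by (auto simp: dist_real_def eventually_conj)
    then obtain N where N: "\<And>n. n \<ge> N \<Longrightarrow> \<bar>(norm (q n))\<^sup>2 - D\<^sup>2\<bar> < e\<^sup>2 / 16 \<and> \<bar>(d n)\<^sup>2 - D\<^sup>2\<bar> < e\<^sup>2 / 16"
      by (auto simp: eventually_sequentially)
    \<comment> \<open>The deviations from D^2 enter \<open>par\<close> with weights 2, 2 and 4, so
      they add up to at most 8 e^2/16 = e^2/2.\<close>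
    have "dist (q m) (q n) < e" if "N \<le> m" "m < n" for m n
    proof -
      have "\<bar>(norm (q m))\<^sup>2 - D\<^sup>2\<bar> < e\<^sup>2 / 16" "\<bar>(d m)\<^sup>2 - D\<^sup>2\<bar> < e\<^sup>2 / 16" "\<bar>(norm (q n))\<^sup>2 - D\<^sup>2\<bar> < e\<^sup>2 / 16"
        using N [of m] N [of n] that by auto
      then have "(norm (q m - q n))\<^sup>2 < e\<^sup>2"
        using par [of m n] that e by (auto simp: abs_if split: if_splits)
      then show ?thesis
        using e by (simp add: dist_norm power_less_imp_less_base)
    qed
    then show "\<exists>N. \<forall>m\<ge>N. \<forall>n>m. dist (q m) (q n) < e" by blast
  qed
  then obtain l where "q \<longlonglongrightarrow> l"
    using Cauchy_convergent_iff convergent_def by blast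
  with q(1) [unfolded H_def] show ?thesis
    by (rule that)
qed

text \<open>Open balls are convex and so are their preimages under \<open>f\<close>; once a tail of
  \<open>f (a n)\<close> lies in a ball, so does the image of its convex hull.\<close>

lemma tendsto_tail_convex_combinations:
  assumes q: "\<And>n. q n \<in> convex hull (a ` {n..})" and f: "bounded_linear f"
    and lim: "(\<lambda>n. f (a n)) \<longlonglongrightarrow> (l :: 'b::real_normed_vector)"
  shows "(\<lambda>n. f (q n)) \<longlonglongrightarrow> l"
proof (rule tendstoI)
  fix e :: real assume "e > 0"
  then obtain N where N: "\<And>n. n \<ge> N \<Longrightarrow> f (a n) \<in> ball l e"
    using tendstoD [OF lim] by (auto simp: eventually_sequentially dist_commute)
  have "f (q n) \<in> ball l e" if "n \<ge> N" for n
  proof -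
    have "convex hull (a ` {n..}) \<subseteq> f -` ball l e"
      using N that f by (intro hull_minimal convex_linear_vimage)
        (auto simp: bounded_linear.linear)
    with q [of n] show ?thesis by blast
  qed
  then show "\<forall>\<^sub>F n in sequentially. dist (f (q n)) l < e"
    by (auto simp: eventually_sequentially dist_commute)
qed

text \<open>If the bound fails for every C, normalised triples have first entries tending to 0,
  bounded second entries, and third entries of norm 1 that converge along a subsequence. Convex
  combinations make the second entries converge as well, and the limit contradicts
  \<open>closable\<close>. Triples cover both graphs over a domain and resolvents parametrised by
  their argument.\<close>

lemma relative_bound_zero:
  fixes S :: "('b::{real_inner, complete_space} \<times> 'b \<times> 'b) set"
  assumes S: "subspace S"
    and cpt: "\<And>r. compact (closure {c. \<exists>a b. (a, b, c) \<in> S \<and> norm a \<le> r \<and> norm b \<le> r})"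
    and closable: "\<And>b c. (0, b, c) \<in> closure S \<Longrightarrow> c = 0"
    and \<eta>: "\<eta> > 0"
  obtains C where "C \<ge> 0" "\<And>a b c. (a, b, c) \<in> S \<Longrightarrow> norm c \<le> \<eta> * norm b + C * norm a"
proof (rule ccontr)
  assume "\<not> thesis"
  with that have "\<not> (\<forall>a b c. (a, b, c) \<in> S \<longrightarrow> norm c \<le> \<eta> * norm b + real (Suc n) * norm a)" for n
    by (metis of_nat_0_le_iff)
  then obtain a b c where abc: "\<And>n. (a n, b n, c n) \<in> S"
    "\<And>n. \<eta> * norm (b n) + real (Suc n) * norm (a n) < norm (c n)"
    by (metis linorder_not_le)
  \<comment> \<open>The third entry gets norm 1, and the failed bound with C = n + 1 makes the first
    entry at most 1/(n + 1).\<close>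
  define s where "s n = inverse (norm (c n)) *\<^sub>R (a n, b n, c n)" for n
  have c: "norm (c n) > 0" for n
    using abc(2) [of n] \<eta>
    by (smt (verit) mult_nonneg_nonneg norm_ge_zero of_nat_0_le_iff)
  have sS: "s n \<in> S" for n
    unfolding s_def by (rule subspace_scale [OF S abc(1)])
  have s3: "norm (snd (snd (s n))) = 1" for n
    using c [of n] by (simp add: s_def)
  have s12: "\<eta> * norm (fst (snd (s n))) + real (Suc n) * norm (fst (s n)) \<le> 1" for n
  proof -
    have "inverse (norm (c n)) * (\<eta> * norm (b n) + real (Suc n) * norm (a n)) \<le> inverse (norm (c n)) * norm (c n)"
      using abc(2) [of n] c [of n] by (intro mult_left_mono) auto
    then show ?thesis
      using c [of n] by (simp add: s_def algebra_simps)
  qed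
  have s2: "norm (fst (snd (s n))) \<le> 1 / \<eta>" for n
    using s12 [of n] \<eta> by (simp add: field_simps) (smt (verit) mult_nonneg_nonneg norm_ge_zero of_nat_0_le_iff)
  have s1: "norm (fst (s n)) \<le> 1 / real (Suc n)" for n
  proof -
    have "0 \<le> \<eta> * norm (fst (snd (s n)))" using \<eta> by simp
    then have "real (Suc n) * norm (fst (s n)) \<le> 1" using s12 [of n] by linarith
    then show ?thesis by (simp add: field_simps)
  qed
  have s1': "norm (fst (s n)) \<le> 1" for n
    using s1 [of n] by (rule order_trans) simp
  define r where "r = max 1 (1 / \<eta>)"
  have "snd (snd (s n)) \<in> closure {c. \<exists>a b. (a, b, c) \<in> S \<and> norm a \<le> r \<and> norm b \<le> r}" for n
    using sS [of n] s1' [of n] s2 [of n]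
    by (intro subsetD [OF closure_subset] CollectI exI [of _ "fst (s n)"] exI [of _ "fst (snd (s n))"])
      (auto simp: r_def)
  then obtain y \<rho> where y: "strict_mono \<rho>" "((\<lambda>n. snd (snd (s n))) \<circ> \<rho>) \<longlonglongrightarrow> y"
    using cpt [of r] unfolding compact_def by (metis (no_types, lifting))
  have "norm y = 1"
    using tendsto_norm [OF y(2)] by (simp add: o_def s3 LIMSEQ_const_iff)
  \<comment> \<open>The second entries of \<open>t\<close> are merely bounded. Convex combinations
    of tails make them converge, keep the limits of the other two entries and stay in
    \<open>S\<close>.\<close>
  define t where "t = s \<circ> \<rho>"
  have "norm (t n) \<le> 1 + (1 / \<eta> + 1)" for n
    using norm_Pair_le [of "fst (t n)" "snd (t n)"] norm_Pair_le [of "fst (snd (t n))" "snd (snd (t n))"]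
      s1' [of "\<rho> n"] s2 [of "\<rho> n"] s3 [of "\<rho> n"] by (simp add: t_def)
  then have "bounded (range t)"
    by (auto simp: bounded_iff)
  then obtain q l where q: "\<And>n. q n \<in> convex hull (t ` {n..})" "q \<longlonglongrightarrow> l"
    by (rule convergent_tail_convex_combinations) (rule that)
  have "convex hull (t ` {n..}) \<subseteq> S" for n
    using S sS by (intro hull_minimal) (auto simp: t_def subspace_imp_convex)
  then have l: "l \<in> closure S"
    using q by (meson closure_sequential subsetD)
  have "(\<lambda>n. fst (s n)) \<longlonglongrightarrow> 0"
  proof (rule Lim_null_comparison)
    show "\<forall>\<^sub>F n in sequentially. norm (fst (s n)) \<le> 1 / real (Suc n)"
      using s1 by simp
    show "(\<lambda>n. 1 / real (Suc n)) \<longlonglongrightarrow> 0" by real_asymp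
  qed
  then have "(\<lambda>n. fst (t n)) \<longlonglongrightarrow> 0"
    using LIMSEQ_subseq_LIMSEQ [OF _ y(1)] by (fastforce simp: t_def o_def)
  then have "(\<lambda>n. fst (q n)) \<longlonglongrightarrow> 0"
    by (rule tendsto_tail_convex_combinations [OF q(1) bounded_linear_fst])
  then have "fst l = 0"
    using tendsto_fst [OF q(2)] LIMSEQ_unique by blast
  have "(\<lambda>n. snd (snd (q n))) \<longlonglongrightarrow> y"
    using y(2) bounded_linear_compose [OF bounded_linear_snd bounded_linear_snd]
    by (intro tendsto_tail_convex_combinations [OF q(1)]) (auto simp: t_def o_def)
  then have "snd (snd l) = y"
    using tendsto_snd [OF tendsto_snd [OF q(2)]] LIMSEQ_unique by blast
  with l \<open>fst l = 0\<close> have "(0, fst (snd l), y) \<in> closure S"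
    by (metis prod.collapse)
  from closable [OF this] \<open>norm y = 1\<close> show False by simp
qed

subsection \<open>Uniform form of the sequence conditions\<close>

text \<open>If no \<open>\<epsilon>\<close> works, violators for 1/(n + 1) form a sequence with
  \<open>f (x n)\<close> tending to 0 and liminf at most 0. One \<open>\<epsilon>\<close> serves as
  threshold and as lower bound, since either may be decreased.\<close>

lemma liminf_pos_iff_uniform:
  fixes f :: "'b \<Rightarrow> 'c::real_normed_vector" and h :: "'b \<Rightarrow> real"
  shows "(\<forall>x. (\<forall>n. x n \<in> X) \<and> (\<lambda>n. f (x n)) \<longlonglongrightarrow> 0 \<longrightarrow> liminf (\<lambda>n. ereal (h (x n))) > 0) \<longleftrightarrow>
    (\<exists>\<epsilon>>0. \<forall>x\<in>X. norm (f x) < \<epsilon> \<longrightarrow> \<epsilon> \<le> h x)" (is "?L \<longleftrightarrow> ?R")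
proof
  assume ?R
  then obtain \<epsilon> where \<epsilon>: "\<epsilon> > 0" "\<And>x. x \<in> X \<Longrightarrow> norm (f x) < \<epsilon> \<Longrightarrow> \<epsilon> \<le> h x" by blast
  show ?L
  proof (intro allI impI, elim conjE)
    fix x assume x: "\<forall>n. x n \<in> X" "(\<lambda>n. f (x n)) \<longlonglongrightarrow> 0"
    have "\<forall>\<^sub>F n in sequentially. ereal \<epsilon> \<le> ereal (h (x n))"
      using tendstoD [OF x(2) \<epsilon>(1)] by eventually_elim (use x(1) \<epsilon>(2) in auto)
    then have "ereal \<epsilon> \<le> liminf (\<lambda>n. ereal (h (x n)))"
      by (rule Liminf_bounded)
    with \<epsilon>(1) show "0 < liminf (\<lambda>n. ereal (h (x n)))"
      by (metis ereal_less(2) less_le_trans)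
  qed
next
  assume L: ?L
  show ?R
  proof (rule ccontr)
    assume "\<not> ?R"
    then have "\<exists>x\<in>X. norm (f x) < 1 / real (Suc n) \<and> h x < 1 / real (Suc n)" for n
      by (metis linorder_not_le of_nat_0_less_iff zero_less_Suc zero_less_divide_1_iff)
    then obtain x where x: "\<And>n. x n \<in> X" "\<And>n. norm (f (x n)) < 1 / real (Suc n)"
      "\<And>n. h (x n) < 1 / real (Suc n)"
      by metis
    have lim: "(\<lambda>n. 1 / real (Suc n)) \<longlonglongrightarrow> 0" by real_asymp
    then have "(\<lambda>n. f (x n)) \<longlonglongrightarrow> 0"
      by (rule Lim_null_comparison [rotated]) (use x(2) in \<open>auto simp: less_imp_le\<close>)
    with L x(1) have "liminf (\<lambda>n. ereal (h (x n))) > 0" by blast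
    moreover have "liminf (\<lambda>n. ereal (h (x n))) \<le> liminf (\<lambda>n. ereal (1 / real (Suc n)))"
      using x(3) by (intro Liminf_mono) (auto simp: less_imp_le)
    moreover have "liminf (\<lambda>n. ereal (1 / real (Suc n))) = 0"
      using lim by (intro lim_imp_Liminf) (auto simp: zero_ereal_def)
    ultimately show False by simp
  qed
qed

lemma Re_gform: "Re (gform G x y) = inner (G x) y"
  by (simp add: gform_def Re_cinner)

lemma positive_on_Fin_iff:
  "positive_on G A (Fin z) L \<longleftrightarrow> (\<exists>\<epsilon>>0. \<forall>x\<in>{x\<in>L \<inter> odom A. norm x = 1}.
     norm (app A x - z *\<^sub>C x) < \<epsilon> \<longrightarrow> \<epsilon> \<le> inner (G x) x)"
  using liminf_pos_iff_uniform [of "{x\<in>L \<inter> odom A. norm x = 1}" "\<lambda>x. app A x - z *\<^sub>C x" "\<lambda>x. inner (G x) x"]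
  by (simp add: Re_gform)

lemma positive_on_Infty_iff:
  "positive_on G A Infty L \<longleftrightarrow> (\<exists>\<epsilon>>0. \<forall>x\<in>{x\<in>L \<inter> odom A. norm (app A x) = 1}.
     norm x < \<epsilon> \<longrightarrow> \<epsilon> \<le> inner (G (app A x)) (app A x))"
  using liminf_pos_iff_uniform [of "{x\<in>L \<inter> odom A. norm (app A x) = 1}" "\<lambda>x. x"
      "\<lambda>x. inner (G (app A x)) (app A x)"]
  by (simp add: Re_gform)

text \<open>Rescaling to unit vectors gives a homogeneous form of the condition that applies to
  \<open>T x\<close>, whose norm is only close to 1.\<close>

lemma positive_on_FinD:
  assumes pos: "positive_on G A (Fin z) L" and A: "linear_opr A" and L: "csubspace L"
    and G: "bounded_linear G"
  obtains \<epsilon> where "\<epsilon> > 0"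
    "\<And>x. x \<in> L \<inter> odom A \<Longrightarrow> norm (app A x - z *\<^sub>C x) < \<epsilon> * norm x \<Longrightarrow> \<epsilon> * (norm x)\<^sup>2 \<le> inner (G x) x"
proof -
  note A' = clinear_onD [OF A [unfolded linear_opr_clinear_on]]
  obtain \<epsilon> where \<epsilon>: "\<epsilon> > 0" "\<And>x. x \<in> L \<Longrightarrow> x \<in> odom A \<Longrightarrow> norm x = 1 \<Longrightarrow>
      norm (app A x - z *\<^sub>C x) < \<epsilon> \<Longrightarrow> \<epsilon> \<le> inner (G x) x"
    using pos unfolding positive_on_Fin_iff by blast
  have "\<epsilon> * (norm x)\<^sup>2 \<le> inner (G x) x"
    if x: "x \<in> L \<inter> odom A" "norm (app A x - z *\<^sub>C x) < \<epsilon> * norm x" for x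
  proof -
    define r where "r = inverse (norm x)"
    \<comment> \<open>The strict inequality rules out x = 0.\<close>
    have nz: "norm x > 0"
      using x(2) by (cases "x = 0") auto
    then have r: "r > 0" by (simp add: r_def)
    have "app A (r *\<^sub>R x) - z *\<^sub>C (r *\<^sub>R x) = r *\<^sub>R (app A x - z *\<^sub>C x)"
      using A'(4) x(1) by (simp add: scaleC_scaleR scaleR_diff_right)
    then have "norm (app A (r *\<^sub>R x) - z *\<^sub>C (r *\<^sub>R x)) = r * norm (app A x - z *\<^sub>C x)"
      using r by simp
    also have "\<dots> < \<epsilon>"
      using x(2) nz by (simp add: r_def field_simps)
    finally have "norm (app A (r *\<^sub>R x) - z *\<^sub>C (r *\<^sub>R x)) < \<epsilon>" .
    then have "\<epsilon> \<le> inner (G (r *\<^sub>R x)) (r *\<^sub>R x)"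
      using nz x(1) csubspace_scaleR [OF L] csubspace_scaleR [OF A'(1)]
      by (intro \<epsilon>(2)) (auto simp: r_def)
    then have "\<epsilon> \<le> r\<^sup>2 * inner (G x) x"
      by (simp add: bounded_linear.linear [OF G] linear_cmul power2_eq_square)
    then show ?thesis
      using nz by (simp add: r_def field_simps)
  qed
  with \<epsilon>(1) show ?thesis using that by blast
qed

lemma positive_on_InftyD:
  assumes pos: "positive_on G A Infty L" and A: "linear_opr A" and L: "csubspace L"
    and G: "bounded_linear G"
  obtains \<epsilon> where "\<epsilon> > 0"
    "\<And>x. x \<in> L \<inter> odom A \<Longrightarrow> norm x < \<epsilon> * norm (app A x) \<Longrightarrow>
      \<epsilon> * (norm (app A x))\<^sup>2 \<le> inner (G (app A x)) (app A x)"
proof -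
  note A' = clinear_onD [OF A [unfolded linear_opr_clinear_on]]
  obtain \<epsilon> where \<epsilon>: "\<epsilon> > 0" "\<And>x. x \<in> L \<Longrightarrow> x \<in> odom A \<Longrightarrow> norm (app A x) = 1 \<Longrightarrow>
      norm x < \<epsilon> \<Longrightarrow> \<epsilon> \<le> inner (G (app A x)) (app A x)"
    using pos unfolding positive_on_Infty_iff by blast
  have "\<epsilon> * (norm (app A x))\<^sup>2 \<le> inner (G (app A x)) (app A x)"
    if x: "x \<in> L \<inter> odom A" "norm x < \<epsilon> * norm (app A x)" for x
  proof -
    define r where "r = inverse (norm (app A x))"
    have nz: "norm (app A x) > 0"
      using x(2) by (cases "app A x = 0") auto
    then have r: "r > 0" by (simp add: r_def)
    have Ar: "app A (r *\<^sub>R x) = r *\<^sub>R app A x"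
      using A'(4) x(1) by simp
    have "norm (r *\<^sub>R x) < \<epsilon>"
      using r x(2) nz by (simp add: r_def field_simps)
    then have "\<epsilon> \<le> inner (G (app A (r *\<^sub>R x))) (app A (r *\<^sub>R x))"
      using nz x(1) csubspace_scaleR [OF L] csubspace_scaleR [OF A'(1)] Ar
      by (intro \<epsilon>(2)) (auto simp: r_def)
    then have "\<epsilon> \<le> r\<^sup>2 * inner (G (app A x)) (app A x)"
      by (simp add: Ar bounded_linear.linear [OF G] linear_cmul power2_eq_square)
    then show ?thesis
      using nz by (simp add: r_def field_simps)
  qed
  with \<epsilon>(1) show ?thesis using that by blast
qed

text \<open>Positivity passes from \<open>y\<close> to a nearby unit vector \<open>x\<close>: the
  norm of \<open>y\<close> is at least 1/2, so the form at \<open>y\<close> is at least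
  \<epsilon>/4, and the change of vector costs at most half of that.\<close>

lemma quadratic_form_perturbation:
  fixes G :: "'b::real_inner \<Rightarrow> 'b"
  assumes G: "bounded_linear G" and \<epsilon>: "\<epsilon> > 0"
  obtains e where "e > 0" "e \<le> 1 / 2"
    "\<And>x y. norm x = 1 \<Longrightarrow> norm (y - x) \<le> e \<Longrightarrow> \<epsilon> * (norm y)\<^sup>2 \<le> inner (G y) y \<Longrightarrow> \<epsilon> / 8 \<le> inner (G x) x"
proof -
  obtain c where c: "c > 0" "\<And>x. norm (G x) \<le> norm x * c"
    using bounded_linear.pos_bounded [OF G] by blast
  \<comment> \<open>The two error terms are at most (3/2) c e and c e; 20 c e \<le> \<epsilon> keeps
    their sum within \<epsilon>/8.\<close>
  define e where "e = min (1 / 2) (\<epsilon> / (20 * c))"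
  have e: "e > 0" "e \<le> 1 / 2" "20 * (c * e) \<le> \<epsilon>"
    using c \<epsilon> by (auto simp: e_def min_def field_simps)
  have "\<epsilon> / 8 \<le> inner (G x) x"
    if x: "norm x = 1" "norm (y - x) \<le> e" "\<epsilon> * (norm y)\<^sup>2 \<le> inner (G y) y" for x y
  proof -
    have y: "1 / 2 \<le> norm y" "norm y \<le> 3 / 2"
      using x(1,2) e(2) norm_triangle_ineq2 [of x y] norm_triangle_ineq2 [of y x]
      by (auto simp: norm_minus_commute)
    have "(1 / 2)\<^sup>2 \<le> (norm y)\<^sup>2"
      using y(1) by (intro power_mono) auto
    then have "\<epsilon> / 4 \<le> \<epsilon> * (norm y)\<^sup>2"
      using \<epsilon> by (simp add: power2_eq_square field_simps)
    moreover have "inner (G y) y - inner (G x) x = inner (G (y - x)) y + inner (G x) (y - x)"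
      using G by (simp add: bounded_linear.linear linear_diff inner_diff_left inner_diff_right)
    moreover have "inner (G (y - x)) y \<le> (e * c) * (3 / 2)"
      using norm_cauchy_schwarz [of "G (y - x)" y] c(2) [of "y - x"] x(2) y(2) c(1) e(1)
      by (smt (verit, best) mult_mono mult_nonneg_nonneg mult_right_mono norm_ge_zero)
    moreover have "inner (G x) (y - x) \<le> c * e"
      using norm_cauchy_schwarz [of "G x" "y - x"] c(2) [of x] x(1,2) c(1)
      by (smt (verit, best) mult_mono norm_ge_zero mult_cancel_right1)
    ultimately show ?thesis
      using x(3) e(3) by (simp add: algebra_simps)
  qed
  with e(1,2) show ?thesis using that by blast
qed

subsection \<open>Compactly close operators\<close>

text \<open>Both hypotheses of the theorem give such a \<open>T\<close>, in either direction: the identity in the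
  first case, \<open>(A - \<mu>)\<^sup>-\<^sup>1 (B - \<mu>)\<close> in the second. The estimate on a manifold of finite codimension
  governs the finite points, the global one the point \<open>\<infinity>\<close>.\<close>

definition compactly_close ::
  "('a::complex_hilbert_space \<Rightarrow> 'a) \<Rightarrow> 'a opr \<Rightarrow> 'a opr \<Rightarrow> bool" where
  "compactly_close T A B \<longleftrightarrow> clinear_on (odom B) T \<and> T ` odom B \<subseteq> odom A \<and>
     (\<forall>\<eta>>0. \<exists>L. fincodim L \<and> (\<forall>x\<in>L \<inter> odom B.
        norm (T x - x) \<le> \<eta> * (norm x + norm (app B x)) \<and>
        norm (app A (T x) - app B x) \<le> \<eta> * (norm x + norm (app B x)))) \<and>
     (\<forall>\<eta>>0. \<exists>C\<ge>0. \<forall>x\<in>odom B.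
        norm (T x - x) \<le> \<eta> * norm (app B x) + C * norm x \<and>
        norm (app A (T x) - app B x) \<le> \<eta> * norm (app B x) + C * norm x)"

text \<open>Intersect the manifold where \<open>T\<close> is nearly the identity with one that
  \<open>T\<close> maps into \<open>L\<close>: there an approximate eigenvector \<open>x\<close> of
  \<open>B\<close> yields an approximate eigenvector \<open>T x\<close> of \<open>A\<close> close to
  \<open>x\<close>.\<close>

lemma compactly_close_positive_on_Fin:
  assumes T: "compactly_close T A B" and A: "linear_opr A" and G: "bounded_linear G"
    and L: "fincodim L" and pos: "positive_on G A (Fin z) L"
  obtains M where "fincodim M" "positive_on G B (Fin z) M"
proof -
  have T_lin: "clinear_on (odom B) T" and T_dom: "\<And>x. x \<in> odom B \<Longrightarrow> T x \<in> odom A"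
    using T by (auto simp: compactly_close_def)
  obtain \<epsilon> where \<epsilon>: "\<epsilon> > 0" "\<And>x. x \<in> L \<inter> odom A \<Longrightarrow> norm (app A x - z *\<^sub>C x) < \<epsilon> * norm x \<Longrightarrow>
      \<epsilon> * (norm x)\<^sup>2 \<le> inner (G x) x"
    using positive_on_FinD [OF pos A _ G] L by (auto simp: fincodim_def)
  obtain e0 where e0: "e0 > 0" "e0 \<le> 1 / 2" "\<And>x y. norm x = 1 \<Longrightarrow> norm (y - x) \<le> e0 \<Longrightarrow>
      \<epsilon> * (norm y)\<^sup>2 \<le> inner (G y) y \<Longrightarrow> \<epsilon> / 8 \<le> inner (G x) x"
    using quadratic_form_perturbation [OF G \<epsilon>(1)] by blast
  \<comment> \<open>\<open>k\<close> bounds \<open>norm x + norm (app B x)\<close> for unit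
    \<open>x\<close> with residual below 1, and dominates the factor 1 + |z| of \<open>e\<close> in
    the residual of \<open>T x\<close>.\<close>
  define k where "k = 2 + cmod z"
  have k: "k > 0" by (simp add: k_def add_pos_nonneg)
  define e where "e = min e0 (\<epsilon> / (8 * k))"
  have e: "e > 0" "e \<le> e0" "8 * (k * e) \<le> \<epsilon>"
    using e0 \<epsilon>(1) k by (auto simp: e_def min_def field_simps)
  \<comment> \<open>The residual of \<open>T x\<close> is below \<delta> + k e \<le> \<epsilon>/4,
    while \<epsilon> times the norm of \<open>T x\<close> is at least \<epsilon>/2. The bound
    \<epsilon>/8 also lets \<delta> serve as lower bound in the uniform condition.\<close>
  define \<delta> where "\<delta> = min 1 (\<epsilon> / 8)"
  have \<delta>: "\<delta> > 0" "\<delta> \<le> 1" "\<delta> \<le> \<epsilon> / 8"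
    using \<epsilon>(1) by (auto simp: \<delta>_def)
  have "e / k > 0" using e k by simp
  then obtain L1 where L1: "fincodim L1" "\<And>x. x \<in> L1 \<inter> odom B \<Longrightarrow>
      norm (T x - x) \<le> e / k * (norm x + norm (app B x)) \<and>
      norm (app A (T x) - app B x) \<le> e / k * (norm x + norm (app B x))"
    using T unfolding compactly_close_def by blast
  obtain L2 where L2: "fincodim L2" "\<And>x. x \<in> L2 \<inter> odom B \<Longrightarrow> T x \<in> L"
    using fincodim_pullback [OF T_lin L] by blast
  have "\<epsilon> / 8 \<le> inner (G x) x"
    if x: "x \<in> L1 \<inter> L2 \<inter> odom B" "norm x = 1" "norm (app B x - z *\<^sub>C x) < \<delta>" for x
  proof (rule e0(3) [OF x(2), of "T x"])
    have "norm (app B x) \<le> norm (app B x - z *\<^sub>C x) + norm (z *\<^sub>C x)"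
      by (metis diff_add_cancel norm_triangle_ineq)
    then have "norm x + norm (app B x) \<le> k"
      using x(2,3) \<delta>(2) by (simp add: norm_scaleC k_def)
    then have "e / k * (norm x + norm (app B x)) \<le> e / k * k"
      using e(1) k by (intro mult_left_mono) auto
    then have *: "norm (T x - x) \<le> e" "norm (app A (T x) - app B x) \<le> e"
      using L1(2) [of x] x(1) k by auto
    then show "norm (T x - x) \<le> e0" using e(2) by simp
    have Az: "app A (T x) - z *\<^sub>C T x = (app B x - z *\<^sub>C x) + (app A (T x) - app B x) - z *\<^sub>C (T x - x)"
      by (simp add: complex_vector.scale_right_diff_distrib)
    have "norm (app A (T x) - z *\<^sub>C T x)
        \<le> norm (app B x - z *\<^sub>C x) + norm (app A (T x) - app B x) + norm (z *\<^sub>C (T x - x))"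
      unfolding Az
      using norm_triangle_ineq4 [of "(app B x - z *\<^sub>C x) + (app A (T x) - app B x)" "z *\<^sub>C (T x - x)"]
        norm_triangle_ineq [of "app B x - z *\<^sub>C x" "app A (T x) - app B x"] by linarith
    also have "\<dots> < \<delta> + e + cmod z * e"
      using x(3) * by (intro add_less_le_mono) (auto simp: norm_scaleC mult_left_mono)
    also have "\<dots> \<le> \<delta> + k * e"
      using e(1) by (simp add: k_def algebra_simps)
    also have "\<dots> \<le> \<epsilon> * (1 / 2)"
      using \<delta>(3) e(3) \<epsilon>(1) by linarith
    also have "\<dots> \<le> \<epsilon> * norm (T x)"
    proof (rule mult_left_mono)
      show "1 / 2 \<le> norm (T x)"
        using norm_triangle_ineq2 [of x "T x"] x(2) * e(2) e0(2) by (simp add: norm_minus_commute)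
    qed (use \<epsilon>(1) in simp)
    finally show "\<epsilon> * (norm (T x))\<^sup>2 \<le> inner (G (T x)) (T x)"
      using \<epsilon>(2) L2(2) T_dom x(1) by blast
  qed
  then have "positive_on G B (Fin z) (L1 \<inter> L2)"
    unfolding positive_on_Fin_iff using \<delta>(1)
    by (intro exI [of _ \<delta>]) (auto intro: order_trans [OF \<delta>(3)])
  with fincodim_Int [OF L1(1) L2(1)] show ?thesis using that by blast
qed

text \<open>The global estimate compares \<open>app A (T x)\<close> with \<open>app B x\<close>, so
  \<open>M\<close> only has to be mapped into \<open>L\<close> by \<open>T\<close>. This covers
  manifolds of finite codimension as well as the whole space for both.\<close>

lemma compactly_close_positive_on_Infty:
  assumes T: "compactly_close T A B" and A: "linear_opr A" and G: "bounded_linear G"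
    and L: "csubspace L" and pos: "positive_on G A Infty L"
    and M: "\<And>x. x \<in> M \<inter> odom B \<Longrightarrow> T x \<in> L"
  shows "positive_on G B Infty M"
proof -
  have T_dom: "\<And>x. x \<in> odom B \<Longrightarrow> T x \<in> odom A"
    using T by (auto simp: compactly_close_def)
  obtain \<epsilon> where \<epsilon>: "\<epsilon> > 0" "\<And>x. x \<in> L \<inter> odom A \<Longrightarrow> norm x < \<epsilon> * norm (app A x) \<Longrightarrow>
      \<epsilon> * (norm (app A x))\<^sup>2 \<le> inner (G (app A x)) (app A x)"
    using positive_on_InftyD [OF pos A L G] by blast
  obtain e0 where e0: "e0 > 0" "e0 \<le> 1 / 2" "\<And>x y. norm x = 1 \<Longrightarrow> norm (y - x) \<le> e0 \<Longrightarrow>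
      \<epsilon> * (norm y)\<^sup>2 \<le> inner (G y) y \<Longrightarrow> \<epsilon> / 8 \<le> inner (G x) x"
    using quadratic_form_perturbation [OF G \<epsilon>(1)] by blast
  define e where "e = min e0 (\<epsilon> / 8)"
  have e: "e > 0" "e \<le> e0" "e \<le> \<epsilon> / 8"
    using e0 \<epsilon>(1) by (auto simp: e_def)
  have "e / 2 > 0" using e by simp
  then obtain C where C: "C \<ge> 0" "\<And>x. x \<in> odom B \<Longrightarrow>
      norm (T x - x) \<le> e / 2 * norm (app B x) + C * norm x \<and>
      norm (app A (T x) - app B x) \<le> e / 2 * norm (app B x) + C * norm x"
    using T unfolding compactly_close_def by metis
  \<comment> \<open>The second bound makes C times the norm of \<open>x\<close> at most e/2, hence
    both errors at most e; C + 1 guards against C = 0. The norm of \<open>T x\<close> is then below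
    e + \<delta> \<le> \<epsilon>/4.\<close>
  define \<delta> where "\<delta> = min (\<epsilon> / 8) (e / (2 * (C + 1)))"
  have \<delta>: "\<delta> > 0" "\<delta> \<le> \<epsilon> / 8" "\<delta> \<le> e / (2 * (C + 1))"
  proof -
    show "\<delta> > 0"
      using \<epsilon>(1) e(1) C(1) by (simp add: \<delta>_def)
  qed (simp_all only: \<delta>_def min.cobounded1 min.cobounded2)
  have "(C + 1) * \<delta> \<le> e / 2"
    using \<delta>(3) C(1) by (simp add: field_simps)
  then have C\<delta>: "C * \<delta> \<le> e / 2" using \<delta>(1) by (simp add: algebra_simps)
  have "\<epsilon> / 8 \<le> inner (G (app B x)) (app B x)"
    if x: "x \<in> M \<inter> odom B" "norm (app B x) = 1" "norm x < \<delta>" for x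
  proof (rule e0(3) [OF x(2), of "app A (T x)"])
    have "C * norm x \<le> C * \<delta>"
      using x(3) C(1) by (intro mult_left_mono) auto
    then have *: "norm (T x - x) \<le> e" "norm (app A (T x) - app B x) \<le> e"
      using C(2) [of x] x(1,2) C\<delta> by auto
    then show "norm (app A (T x) - app B x) \<le> e0" using e(2) by simp
    have "norm (T x) \<le> norm (T x - x) + norm x"
      by (metis diff_add_cancel norm_triangle_ineq)
    also have "\<dots> < \<epsilon> * (1 / 2)"
      using * e(3) \<delta>(2) x(3) \<epsilon>(1) by linarith
    also have "\<dots> \<le> \<epsilon> * norm (app A (T x))"
    proof (rule mult_left_mono)
      show "1 / 2 \<le> norm (app A (T x))"
        using norm_triangle_ineq2 [of "app B x" "app A (T x)"] x(2) * e(2) e0(2)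
        by (simp add: norm_minus_commute)
    qed (use \<epsilon>(1) in simp)
    finally show "\<epsilon> * (norm (app A (T x)))\<^sup>2 \<le> inner (G (app A (T x))) (app A (T x))"
      using \<epsilon>(2) M T_dom x(1) by blast
  qed
  then show ?thesis
    unfolding positive_on_Infty_iff using \<delta>(1)
    by (intro exI [of _ \<delta>]) (auto intro: order_trans [OF \<delta>(2)])
qed

lemma compactly_close_bounded_opr:
  assumes T: "compactly_close T A B" and A: "bounded_opr A"
  shows "bounded_opr B"
proof -
  have T_dom: "\<And>x. x \<in> odom B \<Longrightarrow> T x \<in> odom A"
    using T by (auto simp: compactly_close_def)
  obtain c0 where c0: "\<And>x. x \<in> odom A \<Longrightarrow> norm (app A x) \<le> c0 * norm x"
    using A by (auto simp: bounded_opr_def)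
  \<comment> \<open>The constant in \<open>bounded_opr\<close> may be negative on a trivial domain;
    the estimates below multiply by it monotonically.\<close>
  define c where "c = max c0 0"
  have c: "c \<ge> 0" "\<And>x. x \<in> odom A \<Longrightarrow> norm (app A x) \<le> c * norm x"
    using order_trans [OF c0] by (auto simp: c_def mult_right_mono)
  \<comment> \<open>With (1 + c) \<eta> = 1/2, half of \<open>norm (app B x)\<close> is absorbed on
    the left.\<close>
  define \<eta> where "\<eta> = 1 / (2 * (1 + c))"
  have \<eta>: "\<eta> > 0" "(1 + c) * \<eta> = 1 / 2" using c(1) by (auto simp: \<eta>_def field_simps)
  from \<eta>(1) obtain C where C: "C \<ge> 0" "\<And>x. x \<in> odom B \<Longrightarrow>
      norm (T x - x) \<le> \<eta> * norm (app B x) + C * norm x \<and>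
      norm (app A (T x) - app B x) \<le> \<eta> * norm (app B x) + C * norm x"
    using T unfolding compactly_close_def by metis
  have "norm (app B x) \<le> (2 * (c + (1 + c) * C)) * norm x" if x: "x \<in> odom B" for x
  proof -
    define d where "d = \<eta> * norm (app B x) + C * norm x"
    have "norm (app B x) \<le> norm (app A (T x)) + norm (app A (T x) - app B x)"
      by (metis norm_minus_commute norm_triangle_sub)
    also have "\<dots> \<le> c * norm (T x) + d"
      using c(2) [OF T_dom [OF x]] C(2) [OF x] by (simp add: d_def)
    also have "\<dots> \<le> c * (norm x + d) + d"
      using C(2) [OF x] norm_triangle_sub [of "T x" x] c(1)
      by (intro add_right_mono mult_left_mono) (auto simp: d_def)
    also have "\<dots> = c * norm x + (1 + c) * d"
      by (simp add: algebra_simps)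
    also have "\<dots> = c * norm x + ((1 + c) * \<eta>) * norm (app B x) + (1 + c) * C * norm x"
      by (simp add: d_def algebra_simps)
    finally show ?thesis
      unfolding \<eta>(2) by (simp add: algebra_simps)
  qed
  then show ?thesis by (auto simp: bounded_opr_def)
qed

section \<open>Spectral sets in terms of the sequence conditions\<close>

text \<open>Off the approximate point spectrum no sequence satisfies the premise, so the condition
  holds vacuously on the whole space.\<close>

lemma Fin_in_sigma_pi_plus_Un_reg_ap_iff:
  "Fin z \<in> sigma_pi_plus G A \<union> Fin ` reg_ap A \<longleftrightarrow> (\<exists>L. fincodim L \<and> positive_on G A (Fin z) L)"
proof -
  have "positive_on G A (Fin z) UNIV" if "z \<notin> sigma_ap A"
    using that by (auto simp: sigma_ap_def)
  then have "\<exists>L. fincodim L \<and> positive_on G A (Fin z) L" if "z \<notin> sigma_ap A"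
    using that fincodim_UNIV by blast
  then show ?thesis
    by (cases "z \<in> sigma_ap A")
      (auto simp: sigma_pi_plus_def sigma_ap_ext_def reg_ap_def fincodim_def)
qed

lemma Infty_in_reg_ap_ext_iff: "Infty \<in> reg_ap_ext A \<longleftrightarrow> bounded_opr A"
  by (auto simp: reg_ap_ext_def sigma_ap_ext_def)

lemma Infty_in_sigma_pi_plus_iff:
  "Infty \<in> sigma_pi_plus G A \<longleftrightarrow>
     \<not> bounded_opr A \<and> (\<exists>L. fincodim L \<and> positive_on G A Infty L)"
  by (auto simp: sigma_pi_plus_def sigma_ap_ext_def fincodim_def)

lemma Infty_in_sigma_plus_iff:
  "Infty \<in> sigma_plus G A \<longleftrightarrow> \<not> bounded_opr A \<and> positive_on G A Infty UNIV"
  using fincodim_UNIV by (auto simp: sigma_plus_def Infty_in_sigma_pi_plus_iff)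

text \<open>\<open>T\<close> carries the sequence conditions from \<open>A\<close> to
  \<open>B\<close>; \<open>S\<close> completes the equivalence of boundedness, on which membership
  of \<open>Infty\<close> depends.\<close>

lemma sigma_plus_subset_if_compactly_close:
  assumes T: "compactly_close T A B" and S: "compactly_close S B A"
    and A: "linear_opr A" and G: "bounded_linear G"
  shows "sigma_pi_plus G A \<union> Fin ` reg_ap A \<subseteq> sigma_pi_plus G B \<union> Fin ` reg_ap B"
    and "Infty \<in> sigma_plus G A \<Longrightarrow> Infty \<in> sigma_plus G B"
proof -
  have bdd: "bounded_opr B \<longleftrightarrow> bounded_opr A"
    using compactly_close_bounded_opr T S by blast
  have T_lin: "clinear_on (odom B) T"
    using T by (simp add: compactly_close_def)
  show "sigma_pi_plus G A \<union> Fin ` reg_ap A \<subseteq> sigma_pi_plus G B \<union> Fin ` reg_ap B"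
  proof
    fix w assume w: "w \<in> sigma_pi_plus G A \<union> Fin ` reg_ap A"
    show "w \<in> sigma_pi_plus G B \<union> Fin ` reg_ap B"
    proof (cases w)
      case (Fin z)
      then show ?thesis
        using w compactly_close_positive_on_Fin [OF T A G]
        unfolding Fin Fin_in_sigma_pi_plus_Un_reg_ap_iff by metis
    next
      case Infty
      with w obtain L where L: "\<not> bounded_opr A" "fincodim L" "positive_on G A Infty L"
        by (auto simp: Infty_in_sigma_pi_plus_iff)
      obtain M where M: "fincodim M" "\<And>x. x \<in> M \<inter> odom B \<Longrightarrow> T x \<in> L"
        using fincodim_pullback [OF T_lin L(2)] by blast
      have "csubspace L" using L(2) by (simp add: fincodim_def)
      from compactly_close_positive_on_Infty [OF T A G this L(3) M(2)] M(1) L(1) bdd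
      show ?thesis
        using Infty by (auto simp: Infty_in_sigma_pi_plus_iff)
    qed
  qed
  \<comment> \<open>With the whole space as both manifolds, no dimension is lost.\<close>
  show "Infty \<in> sigma_plus G B" if "Infty \<in> sigma_plus G A"
    using that bdd compactly_close_positive_on_Infty [OF T A G complex_vector.subspace_UNIV]
    by (auto simp: Infty_in_sigma_plus_iff)
qed

section \<open>Negative type by reversing the sign of the form\<close>

lemma negative_on_iff_positive_on: "negative_on G A z L \<longleftrightarrow> positive_on (\<lambda>x. - G x) A z L"
proof -
  have "gform (\<lambda>x. - G x) x y = - gform G x y" for x y
    using cinner_scaleC_left [of "-1" "G x" y] by (simp add: gform_def scaleC_minus1)
  moreover have "limsup (\<lambda>n. ereal (h n)) < 0 \<longleftrightarrow> liminf (\<lambda>n. ereal (- h n)) > 0" for h :: "nat \<Rightarrow> real"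
    using ereal_Liminf_uminus [of sequentially "\<lambda>n. ereal (h n)"] by (simp add: ereal_uminus_less_reorder)
  ultimately show ?thesis
    by (cases z) simp_all
qed

lemma sigma_minus_eq_sigma_plus:
  "sigma_pi_minus G A = sigma_pi_plus (\<lambda>x. - G x) A"
  "sigma_minus G A = sigma_plus (\<lambda>x. - G x) A"
  by (simp_all add: sigma_pi_minus_def sigma_pi_plus_def sigma_minus_def sigma_plus_def
      negative_on_iff_positive_on)

subsection \<open>Relatively compact perturbations\<close>

lemma graph_norm_le: "graph_norm A x \<le> norm x + norm (app A x)"
  unfolding graph_norm_def by (rule sqrt_sum_squares_le_sum) auto

text \<open>The first bound is smallness of the compact map \<open>K\<close> = B - A in the graph
  norm; the second is relative bound zero for the triples (x, A x, K x).\<close>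

lemma relatively_compact_estimates:
  assumes A: "closed_opr A" and B: "closed_opr B" and dom: "odom B = odom A"
    and cpt: "relatively_compact A (diff_opr B A)" and \<eta>: "\<eta> > 0"
  shows "\<exists>L. fincodim L \<and> (\<forall>x\<in>L \<inter> odom A.
      norm (app B x - app A x) \<le> \<eta> * (norm x + norm (app A x)))"
    and "\<exists>C\<ge>0. \<forall>x\<in>odom A. norm (app B x - app A x) \<le> \<eta> * norm (app A x) + C * norm x"
proof -
  define K where "K x = app B x - app A x" for x
  have A_lin: "clinear_on (odom A) (app A)" and B_lin: "clinear_on (odom A) (app B)"
    using A B dom by (simp_all add: closed_opr_def linear_opr_clinear_on)
  note AD = clinear_onD [OF A_lin] and BD = clinear_onD [OF B_lin]
  have K_lin: "clinear_on (odom A) K"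
    using cpt by (simp add: relatively_compact_def linear_opr_clinear_on diff_opr_def dom K_def [abs_def])
  note KD = clinear_onD [OF K_lin]
  have K_cpt: "compact_map (graph_norm A) (odom A) K"
    using cpt by (simp add: relatively_compact_def diff_opr_def K_def [abs_def])
  have N: "graph_norm A (r *\<^sub>R x) = r * graph_norm A x" if "r > 0" "x \<in> odom A" for r x
  proof -
    have "(norm (r *\<^sub>R x))\<^sup>2 + (norm (app A (r *\<^sub>R x)))\<^sup>2 = r\<^sup>2 * ((norm x)\<^sup>2 + (norm (app A x))\<^sup>2)"
      using that AD(4) by (simp add: power_mult_distrib algebra_simps)
    then show ?thesis
      using that by (simp add: graph_norm_def real_sqrt_mult)
  qed
  have N_pos: "graph_norm A x > 0" if "x \<in> odom A" "x \<noteq> 0" for x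
    using that by (simp add: graph_norm_def add_pos_nonneg)
  obtain L where L: "fincodim L" "\<And>x. x \<in> L \<inter> odom A \<Longrightarrow> norm (K x) \<le> \<eta> * graph_norm A x"
    by (rule fincodim_small [OF K_lin K_cpt N N_pos \<eta>]; (assumption | rule that))
  have "norm (K x) \<le> \<eta> * (norm x + norm (app A x))" if "x \<in> L \<inter> odom A" for x
    using L(2) [OF that] mult_left_mono [OF graph_norm_le [of A x], of \<eta>] \<eta> by linarith
  with L(1) show "\<exists>L. fincodim L \<and> (\<forall>x\<in>L \<inter> odom A.
      norm (app B x - app A x) \<le> \<eta> * (norm x + norm (app A x)))"
    by (auto simp: K_def)
  define S where "S = (\<lambda>x. (x, app A x, K x)) ` odom A"
  have S_sub: "subspace S"
    unfolding subspace_def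
  proof (intro conjI ballI allI)
    show "0 \<in> S"
      unfolding S_def using complex_vector.subspace_0 [OF AD(1)] AD(5) KD(5)
      by (auto simp: zero_prod_def intro!: image_eqI [of _ _ 0])
  next
    fix p q assume "p \<in> S" "q \<in> S"
    then obtain x y where "x \<in> odom A" "y \<in> odom A" "p = (x, app A x, K x)" "q = (y, app A y, K y)"
      by (auto simp: S_def)
    then show "p + q \<in> S"
      unfolding S_def using AD(2) KD(2) complex_vector.subspace_add [OF AD(1)]
      by (auto intro!: image_eqI [of _ _ "x + y"])
  next
    fix r and p assume "p \<in> S"
    then obtain x where "x \<in> odom A" "p = (x, app A x, K x)"
      by (auto simp: S_def)
    then show "r *\<^sub>R p \<in> S"
      unfolding S_def using AD(4) KD(4) csubspace_scaleR [OF AD(1)]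
      by (auto intro!: image_eqI [of _ _ "r *\<^sub>R x"])
  qed
  have S_cpt: "compact (closure {c. \<exists>a b. (a, b, c) \<in> S \<and> norm a \<le> r \<and> norm b \<le> r})" for r
  proof -
    have "{c. \<exists>a b. (a, b, c) \<in> S \<and> norm a \<le> r \<and> norm b \<le> r}
        = K ` {x\<in>odom A. norm x \<le> r \<and> norm (app A x) \<le> r}"
      by (auto simp: S_def)
    moreover have "graph_norm A x \<le> 2 * r" if "norm x \<le> r" "norm (app A x) \<le> r" for x
      using graph_norm_le [of A x] that by linarith
    then have "compact (closure (K ` {x\<in>odom A. norm x \<le> r \<and> norm (app A x) \<le> r}))"
      by (intro K_cpt [unfolded compact_map_def, rule_format]) auto
    ultimately show ?thesis by simp
  qed
  \<comment> \<open>For a limit triple (0, b, c), closedness of \<open>A\<close> gives b = 0;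
    closedness of \<open>B\<close>, whose graph contains the pairs (x, A x + K x), gives b + c =
    0.\<close>
  have S_clo: "c = 0" if "(0, b, c) \<in> closure S" for b c
  proof -
    have "(\<lambda>p. (fst p, fst (snd p))) ` closure S \<subseteq> (\<lambda>x. (x, app A x)) ` odom A"
      using A by (intro image_closure_subset continuous_intros) (auto simp: closed_opr_def S_def)
    with that have "(0, b) \<in> (\<lambda>x. (x, app A x)) ` odom A" by force
    then have "b = 0" using AD(5) by auto
    have "(\<lambda>p. (fst p, fst (snd p) + snd (snd p))) ` closure S \<subseteq> (\<lambda>x. (x, app B x)) ` odom B"
      using B dom by (intro image_closure_subset continuous_intros) (auto simp: closed_opr_def S_def K_def)
    with that have "(0, b + c) \<in> (\<lambda>x. (x, app B x)) ` odom B" by force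
    with \<open>b = 0\<close> show ?thesis using BD(5) by auto
  qed
  obtain C where "C \<ge> 0" "\<And>a b c. (a, b, c) \<in> S \<Longrightarrow> norm c \<le> \<eta> * norm b + C * norm a"
    by (rule relative_bound_zero [OF S_sub S_cpt S_clo \<eta>]; (assumption | rule that))
  then show "\<exists>C\<ge>0. \<forall>x\<in>odom A. norm (app B x - app A x) \<le> \<eta> * norm (app A x) + C * norm x"
    by (auto simp: S_def K_def)
qed

lemma relatively_compact_imp_compactly_close:
  assumes A: "closed_opr A" and B: "closed_opr B" and dom: "odom B = odom A"
    and cpt: "relatively_compact A (diff_opr B A)"
  shows "compactly_close (\<lambda>x. x) A B" "compactly_close (\<lambda>x. x) B A"
proof -
  note est = relatively_compact_estimates [OF assms]
  have id: "clinear_on (odom A) (\<lambda>x. x)"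
    using A by (simp add: closed_opr_def linear_opr_def clinear_on_def)
  have ident: "compactly_close (\<lambda>x. x) A' B'"
    if dom': "odom A' = odom A" "odom B' = odom A"
      and fin: "\<And>\<eta>. \<eta> > 0 \<Longrightarrow> \<exists>L. fincodim L \<and> (\<forall>x\<in>L \<inter> odom A.
        norm (app A' x - app B' x) \<le> \<eta> * (norm x + norm (app B' x)))"
      and inf: "\<And>\<eta>. \<eta> > 0 \<Longrightarrow> \<exists>C\<ge>0. \<forall>x\<in>odom A.
        norm (app A' x - app B' x) \<le> \<eta> * norm (app B' x) + C * norm x"
    for A' B' :: "'a opr"
  proof -
    \<comment> \<open>For the identity T x - x vanishes, so the first estimate only asks for a
      nonnegative right-hand side.\<close>
    have "\<exists>C\<ge>0. \<forall>x\<in>odom A. 0 \<le> \<eta> * norm (app B' x) + C * norm x \<and>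
        norm (app A' x - app B' x) \<le> \<eta> * norm (app B' x) + C * norm x" if "\<eta> > 0" for \<eta>
      using inf [OF that] order_trans [OF norm_ge_zero] by meson
    with id dom' fin show ?thesis
      unfolding compactly_close_def by simp
  qed
  from ident [OF dom refl est] show "compactly_close (\<lambda>x. x) B A" .
  \<comment> \<open>A bound relative to \<open>a\<close> becomes one relative to \<open>b\<close>:
    as norm a \<le> norm b + norm (a - b), the share \<eta>/(1 + \<eta>) of
    \<open>norm (a - b)\<close> is absorbed on the left, and dividing by the remaining 1/(1 +
    \<eta>) gives exactly \<eta>.\<close>
  have swap: "norm (a - b) \<le> \<eta> * norm b + C * (1 + \<eta>) * t"
    if "\<eta> > 0" "norm (b - a) \<le> \<eta> / (1 + \<eta>) * norm a + C * t" for \<eta> C t and a b :: 'a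
  proof -
    have "\<eta> / (1 + \<eta>) * norm a \<le> \<eta> / (1 + \<eta>) * (norm b + norm (a - b))"
      using that(1) norm_triangle_sub [of a b] by (intro mult_left_mono) auto
    then have "(1 + \<eta>) * norm (a - b) \<le> (1 + \<eta>) * (\<eta> / (1 + \<eta>) * (norm b + norm (a - b)) + C * t)"
      using that by (intro mult_left_mono) (auto simp: norm_minus_commute)
    also have "\<dots> = \<eta> * (norm b + norm (a - b)) + C * (1 + \<eta>) * t"
      using that(1) by (simp add: field_simps)
    finally show ?thesis by (simp add: algebra_simps)
  qed
  have "\<exists>L. fincodim L \<and> (\<forall>x\<in>L \<inter> odom A. norm (app A x - app B x) \<le> \<eta> * (norm x + norm (app B x)))"
    if "\<eta> > 0" for \<eta>
  proof -
    have "\<eta> / (1 + \<eta>) > 0" using that by simp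
    then obtain L where L: "fincodim L" "\<And>x. x \<in> L \<inter> odom A \<Longrightarrow>
        norm (app B x - app A x) \<le> \<eta> / (1 + \<eta>) * (norm x + norm (app A x))"
      using est(1) by blast
    have c: "\<eta> / (1 + \<eta>) * (1 + \<eta>) = \<eta>" using that by simp
    have "norm (app A x - app B x) \<le> \<eta> * (norm x + norm (app B x))" if x: "x \<in> L \<inter> odom A" for x
    proof -
      have "norm (app B x - app A x) \<le> \<eta> / (1 + \<eta>) * norm (app A x) + \<eta> / (1 + \<eta>) * norm x"
        using L(2) [OF x] by (simp only: distrib_left add.commute)
      from swap [OF \<open>\<eta> > 0\<close> this] show ?thesis
        unfolding c by (simp add: distrib_left)
    qed
    with L(1) show ?thesis by blast
  qed
  moreover have "\<exists>C\<ge>0. \<forall>x\<in>odom A. norm (app A x - app B x) \<le> \<eta> * norm (app B x) + C * norm x"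
    if "\<eta> > 0" for \<eta>
  proof -
    have "\<eta> / (1 + \<eta>) > 0" using that by simp
    then obtain C where C: "C \<ge> 0" "\<And>x. x \<in> odom A \<Longrightarrow>
        norm (app B x - app A x) \<le> \<eta> / (1 + \<eta>) * norm (app A x) + C * norm x"
      using est(2) by blast
    have "C * (1 + \<eta>) \<ge> 0" using C(1) that by simp
    with swap [OF that C(2)] show ?thesis by blast
  qed
  ultimately show "compactly_close (\<lambda>x. x) A B"
    by (rule ident [OF refl dom])
qed

subsection \<open>Compact differences of resolvents\<close>

lemma resolventD:
  assumes A: "linear_opr A" and \<mu>: "\<mu> \<in> resolvent_set A"
  shows "resolvent A \<mu> u \<in> odom A"
    and "app A (resolvent A \<mu> u) = u + \<mu> *\<^sub>C resolvent A \<mu> u"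
    and "x \<in> odom A \<Longrightarrow> resolvent A \<mu> (app A x - \<mu> *\<^sub>C x) = x"
    and "bounded_linear (resolvent A \<mu>)"
    and "clinear_on UNIV (resolvent A \<mu>)"
proof -
  note AD = clinear_onD [OF A [unfolded linear_opr_clinear_on]]
  have bij: "bij_betw (\<lambda>x. app A x - \<mu> *\<^sub>C x) (odom A) UNIV"
    and bl: "bounded_linear (resolvent A \<mu>)"
    using \<mu> by (auto simp: resolvent_set_def)
  show dom: "resolvent A \<mu> u \<in> odom A" for u
    unfolding resolvent_def using bij by (intro inv_into_into) (simp add: bij_betw_def)
  have r: "app A (resolvent A \<mu> u) - \<mu> *\<^sub>C resolvent A \<mu> u = u" for u
    unfolding resolvent_def using bij_betw_inv_into_right [OF bij] by simp
  then show "app A (resolvent A \<mu> u) = u + \<mu> *\<^sub>C resolvent A \<mu> u" for u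
    by (metis diff_add_cancel)
  show l: "resolvent A \<mu> (app A x - \<mu> *\<^sub>C x) = x" if "x \<in> odom A" for x
    unfolding resolvent_def using bij_betw_inv_into_left [OF bij that] .
  show "bounded_linear (resolvent A \<mu>)" by (rule bl)
  \<comment> \<open>\<open>bounded_linear\<close> provides real linearity only; complex homogeneity
    comes from the injectivity of A - \<mu>.\<close>
  have "resolvent A \<mu> (c *\<^sub>C u) = c *\<^sub>C resolvent A \<mu> u" for c u
  proof -
    have "app A (c *\<^sub>C resolvent A \<mu> u) - \<mu> *\<^sub>C c *\<^sub>C resolvent A \<mu> u
        = c *\<^sub>C (app A (resolvent A \<mu> u) - \<mu> *\<^sub>C resolvent A \<mu> u)"
      using AD(3) [OF dom] by (simp add: complex_vector.scale_right_diff_distrib scaleC_scaleC mult.commute)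
    then have "app A (c *\<^sub>C resolvent A \<mu> u) - \<mu> *\<^sub>C c *\<^sub>C resolvent A \<mu> u = c *\<^sub>C u"
      by (simp only: r)
    then show ?thesis
      using l [OF complex_vector.subspace_scale [OF AD(1) dom]] by metis
  qed
  then show "clinear_on UNIV (resolvent A \<mu>)"
    using bl by (simp add: clinear_on_def complex_vector.subspace_UNIV bounded_linear.linear linear_add)
qed

lemma compact_map_compose:
  fixes D P Q :: "'a::complex_hilbert_space \<Rightarrow> 'a"
  assumes D: "compact_map norm UNIV D" and P: "bounded_linear P" and Q: "bounded_linear Q"
  shows "compact_map norm UNIV (\<lambda>x. P (D (Q x)))"
  unfolding compact_map_def
proof (intro allI impI)
  fix S :: "'a set" assume "\<exists>C. \<forall>x\<in>S. norm x \<le> C"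
  then have "bounded (Q ` S)"
    using Q bounded_linear_image by (auto simp: bounded_iff)
  then have "compact (closure (D ` Q ` S))"
    by (intro D [unfolded compact_map_def, rule_format]) (auto simp: bounded_iff)
  then have cpt: "compact (P ` closure (D ` Q ` S))"
    using P by (intro compact_continuous_image linear_continuous_on)
  have "(\<lambda>x. P (D (Q x))) ` S \<subseteq> P ` closure (D ` Q ` S)"
    using closure_subset [of "D ` Q ` S"] by blast
  then have "closure ((\<lambda>x. P (D (Q x))) ` S) \<subseteq> P ` closure (D ` Q ` S)"
    by (rule closure_minimal) (rule compact_imp_closed [OF cpt])
  then show "compact (closure ((\<lambda>x. P (D (Q x))) ` S))"
    using compact_Int_closed [OF cpt closed_closure] by (metis inf.absorb2)
qed

lemma compact_resolvent_difference_commute: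
  assumes "compact_map norm UNIV (\<lambda>x. resolvent A \<mu> x - resolvent B \<mu> x)"
  shows "compact_map norm UNIV (\<lambda>x. resolvent B \<mu> x - resolvent A \<mu> x)"
  using compact_map_compose [OF assms bounded_linear_minus [OF bounded_linear_ident] bounded_linear_ident]
  by simp

text \<open>With k = \<mu> - \<nu> and R denoting resolvents, R_A(\<mu>) - R_B(\<mu>) = (1 + k
  R_A(\<mu>)) (R_A(\<nu>) - R_B(\<nu>)) (1 + k R_B(\<mu>)), and bounded factors preserve
  compactness.\<close>

lemma compact_resolvent_difference_change_point:
  assumes A: "linear_opr A" and B: "linear_opr B"
    and \<mu>: "\<mu> \<in> resolvent_set A" "\<mu> \<in> resolvent_set B"
    and \<nu>: "\<nu> \<in> resolvent_set A" "\<nu> \<in> resolvent_set B"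
    and cpt: "compact_map norm UNIV (\<lambda>x. resolvent A \<nu> x - resolvent B \<nu> x)"
  shows "compact_map norm UNIV (\<lambda>x. resolvent A \<mu> x - resolvent B \<mu> x)"
proof -
  note RA = resolventD [OF A \<mu>(1)] and RB = resolventD [OF B \<mu>(2)]
    and SA = resolventD [OF A \<nu>(1)] and SB = resolventD [OF B \<nu>(2)]
  define k where "k = \<mu> - \<nu>"
  have \<mu>k: "\<mu> = \<nu> + k" by (simp add: k_def)
  define P where "P v = v + k *\<^sub>C resolvent A \<mu> v" for v
  define Q where "Q v = v + k *\<^sub>C resolvent B \<mu> v" for v
  have "resolvent A \<mu> u - resolvent B \<mu> u = P (resolvent A \<nu> (Q u) - resolvent B \<nu> (Q u))" for u
  proof -
    \<comment> \<open>Since (B - \<mu>) b = u, \<open>w\<close> equals (B - \<nu>) b; for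
      \<open>a\<close> = R_A(\<nu>) w this gives (A - \<mu>) a = u - k (a - b).\<close>
    define b where "b = resolvent B \<mu> u"
    define w where "w = u + k *\<^sub>C b"
    define a where "a = resolvent A \<nu> w"
    have "app B b = u + \<mu> *\<^sub>C b"
      unfolding b_def by (rule RB(2))
    then have "app B b - \<nu> *\<^sub>C b = w"
      by (simp add: w_def \<mu>k scaleC_add_left)
    then have b: "resolvent B \<nu> w = b"
      using SB(3) [of b] RB(1) by (simp add: b_def)
    have "app A a = w + \<nu> *\<^sub>C a"
      unfolding a_def by (rule SA(2))
    then have "app A a - \<mu> *\<^sub>C a = u - k *\<^sub>C (a - b)"
      by (simp add: w_def \<mu>k scaleC_add_left complex_vector.scale_right_diff_distrib)
    then have "resolvent A \<mu> (u - k *\<^sub>C (a - b)) = a"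
      using RA(3) [of a] SA(1) by (simp add: a_def)
    then have "resolvent A \<mu> u - k *\<^sub>C resolvent A \<mu> (a - b) = a"
      using clinear_onD(3,6) [OF RA(5)] by simp
    then have "resolvent A \<mu> u - b = (a - b) + k *\<^sub>C resolvent A \<mu> (a - b)"
      by (simp add: algebra_simps)
    then show ?thesis
      using b by (simp add: P_def Q_def a_def w_def b_def)
  qed
  moreover have "bounded_linear P" "bounded_linear Q"
    unfolding P_def Q_def using RA(4) RB(4)
    by (auto intro: bounded_linear_add bounded_linear_ident bounded_linear_compose [OF bounded_linear_scaleC])
  ultimately show ?thesis
    using compact_map_compose [OF cpt, of P Q] by simp
qed

text \<open>For this \<open>T\<close>, T x - x is the resolvent difference applied to (B - \<mu>) x,
  and A T x - B x = \<mu> (T x - x), so everything reduces to bounds on T x - x.\<close>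

lemma compact_resolvent_difference_imp_compactly_close:
  assumes A: "linear_opr A" and B: "linear_opr B"
    and \<mu>: "\<mu> \<in> resolvent_set A" "\<mu> \<in> resolvent_set B"
    and cpt: "compact_map norm UNIV (\<lambda>x. resolvent A \<mu> x - resolvent B \<mu> x)"
  shows "compactly_close (\<lambda>x. resolvent A \<mu> (app B x - \<mu> *\<^sub>C x)) A B"
proof -
  note RA = resolventD [OF A \<mu>(1)] and RB = resolventD [OF B \<mu>(2)]
  note BD = clinear_onD [OF B [unfolded linear_opr_clinear_on]]
    and RAD = clinear_onD [OF RA(5)] and RBD = clinear_onD [OF RB(5)]
  define D where "D u = resolvent A \<mu> u - resolvent B \<mu> u" for u
  define U where "U x = app B x - \<mu> *\<^sub>C x" for x
  define T where "T x = resolvent A \<mu> (U x)" for x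
  \<comment> \<open>\<open>m\<close> dominates 1 and |\<mu>|, so a bound for
    \<open>m * norm (T x - x)\<close> gives both estimates; it also controls the growth of
    \<open>U\<close>.\<close>
  define m where "m = 1 + cmod \<mu>"
  have m: "m \<ge> 1" by (simp add: m_def)
  have D_bl: "bounded_linear D"
    unfolding D_def by (intro bounded_linear_sub RA(4) RB(4))
  have D_lin: "clinear_on UNIV D"
    using RAD RBD by (simp add: clinear_on_def D_def complex_vector.scale_right_diff_distrib)
  have D_cpt: "compact_map norm UNIV D"
    using cpt by (simp add: D_def [abs_def])
  have U_lin: "clinear_on (odom B) U"
    using BD by (simp add: clinear_on_def U_def scaleC_add_right complex_vector.scale_right_diff_distrib
        scaleC_scaleC mult.commute)
  have T_lin: "clinear_on (odom B) T"
    using clinear_onD [OF U_lin] RAD by (simp add: clinear_on_def T_def)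
  have T_dom: "T ` odom B \<subseteq> odom A"
    using RA(1) by (auto simp: T_def)
  have TD: "T x - x = D (U x)" if "x \<in> odom B" for x
    using RB(3) [OF that] by (simp add: T_def D_def U_def)
  have "app A (T x) - app B x = \<mu> *\<^sub>C (T x - x)" for x
    using RA(2) [of "U x"] by (simp add: T_def U_def complex_vector.scale_right_diff_distrib)
  then have "norm (app A (T x) - app B x) \<le> m * norm (T x - x)" for x
    by (simp add: norm_scaleC m_def distrib_right)
  moreover have "norm (T x - x) \<le> m * norm (T x - x)" for x
    using mult_right_mono [OF m norm_ge_zero, of "T x - x"] by simp
  ultimately have est: "norm (T x - x) \<le> c \<and> norm (app A (T x) - app B x) \<le> c"
    if "m * norm (T x - x) \<le> c" for x c
    using that order_trans by blast
  have U_le: "norm (U x) \<le> norm (app B x) + cmod \<mu> * norm x" for x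
    using norm_triangle_ineq4 [of "app B x" "\<mu> *\<^sub>C x"] by (simp add: U_def norm_scaleC)
  have "\<exists>L. fincodim L \<and> (\<forall>x\<in>L \<inter> odom B. m * norm (T x - x) \<le> \<eta> * (norm x + norm (app B x)))"
    if "\<eta> > 0" for \<eta>
  proof -
    \<comment> \<open>One factor 1/m offsets the \<open>m\<close> in front of the norm of T x - x,
      the other the bound of \<open>U x\<close> by m (norm x + norm (B x)).\<close>
    have pos: "\<eta> / m\<^sup>2 > 0" using that m by simp
    obtain L where L: "fincodim L" "\<And>u. u \<in> L \<inter> UNIV \<Longrightarrow> norm (D u) \<le> \<eta> / m\<^sup>2 * norm u"
      by (rule fincodim_small [OF D_lin D_cpt _ _ pos]) auto
    obtain M where M: "fincodim M" "\<And>x. x \<in> M \<inter> odom B \<Longrightarrow> U x \<in> L"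
      using fincodim_pullback [OF U_lin L(1)] by blast
    have "m * norm (T x - x) \<le> \<eta> * (norm x + norm (app B x))" if x: "x \<in> M \<inter> odom B" for x
    proof -
      have "norm (U x) \<le> m * (norm x + norm (app B x))"
        using U_le [of x] norm_ge_zero [of x] mult_nonneg_nonneg [OF norm_ge_zero norm_ge_zero, of \<mu> "app B x"]
        unfolding m_def distrib_left distrib_right by linarith
      then have "m * (\<eta> / m\<^sup>2 * norm (U x)) \<le> m * (\<eta> / m\<^sup>2 * (m * (norm x + norm (app B x))))"
        using pos m by (intro mult_left_mono) auto
      also have "\<dots> = \<eta> * (norm x + norm (app B x))"
        using m by (simp add: power2_eq_square)
      finally show ?thesis
        using L(2) [of "U x"] M(2) [OF x] TD [of x] x m
        by (smt (verit, best) IntD2 IntI UNIV_I mult_left_mono)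
    qed
    with M(1) show ?thesis by blast
  qed
  moreover have "\<exists>C\<ge>0. \<forall>x\<in>odom B. m * norm (T x - x) \<le> \<eta> * norm (app B x) + C * norm x"
    if \<eta>: "\<eta> > 0" for \<eta>
  proof -
    have pos: "\<eta> / m > 0" using that m by simp
    \<comment> \<open>At u = U x the triple is (x, U x, T x - x), so the relative bound for
      \<open>D\<close> becomes one in terms of \<open>x\<close>.\<close>
    define S where "S = range (\<lambda>u. (resolvent B \<mu> u, u, D u))"
    have "linear (\<lambda>u. (resolvent B \<mu> u, u, D u))"
      using D_bl RB(4) by (intro bounded_linear.linear bounded_linear_Pair bounded_linear_ident)
    then have S_sub: "subspace S"
      unfolding S_def by (rule linear_subspace_image) (rule subspace_UNIV)
    have S_cpt: "compact (closure {c. \<exists>a b. (a, b, c) \<in> S \<and> norm a \<le> r \<and> norm b \<le> r})" for r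
    proof -
      have "{c. \<exists>a b. (a, b, c) \<in> S \<and> norm a \<le> r \<and> norm b \<le> r}
          = D ` {u. norm (resolvent B \<mu> u) \<le> r \<and> norm u \<le> r}"
        by (auto simp: S_def)
      moreover have "compact (closure (D ` {u. norm (resolvent B \<mu> u) \<le> r \<and> norm u \<le> r}))"
        by (intro D_cpt [unfolded compact_map_def, rule_format]) auto
      ultimately show ?thesis by simp
    qed
    have S_clo: "c = 0" if "(0, b, c) \<in> closure S" for b c
    proof -
      \<comment> \<open>By continuity a limit triple still has the form (R_B(\<mu>) b, b, D b); a
        vanishing first entry forces b = 0 because the resolvent is injective.\<close>
      have "closed {p. fst p = resolvent B \<mu> (fst (snd p)) \<and> snd (snd p) = D (fst (snd p))}"
        by (intro closed_Collect_conj closed_Collect_eq continuous_intros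
            bounded_linear.continuous_on [OF RB(4)] bounded_linear.continuous_on [OF D_bl])
      then have "closure S \<subseteq> {p. fst p = resolvent B \<mu> (fst (snd p)) \<and> snd (snd p) = D (fst (snd p))}"
        by (intro closure_minimal) (auto simp: S_def)
      with that have "resolvent B \<mu> b = 0" "c = D b" by force+
      moreover from this(1) have "b = 0"
        using RB(2) [of b] BD(5) by simp
      ultimately show ?thesis
        using clinear_onD(5) [OF D_lin] by simp
    qed
    obtain C where C: "C \<ge> 0"
      "\<And>a b c. (a, b, c) \<in> S \<Longrightarrow> norm c \<le> \<eta> / m * norm b + C * norm a"
      by (rule relative_bound_zero [OF S_sub S_cpt S_clo pos]; (assumption | rule that))
    have "m * norm (T x - x) \<le> \<eta> * norm (app B x) + (\<eta> * cmod \<mu> + m * C) * norm x"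
      if x: "x \<in> odom B" for x
    proof -
      have "norm (D (U x)) \<le> \<eta> / m * norm (U x) + C * norm x"
        using C(2) [of x "U x" "D (U x)"] RB(3) [OF x] by (auto simp: S_def U_def image_iff)
      then have "m * norm (T x - x) \<le> m * (\<eta> / m * norm (U x) + C * norm x)"
        using TD [OF x] m by (intro mult_left_mono) auto
      also have "\<dots> = \<eta> * norm (U x) + m * C * norm x"
        using m by (simp add: distrib_left)
      also have "\<dots> \<le> \<eta> * (norm (app B x) + cmod \<mu> * norm x) + m * C * norm x"
        using U_le \<eta> by (intro add_right_mono mult_left_mono) auto
      finally show ?thesis by (simp add: algebra_simps)
    qed
    moreover have "\<eta> * cmod \<mu> + m * C \<ge> 0"
      using \<eta> m C(1) by simp
    ultimately show ?thesis by blast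
  qed
  ultimately have "compactly_close T A B"
    unfolding compactly_close_def using T_lin T_dom est by (metis (no_types, lifting))
  then show ?thesis
    by (simp add: T_def [abs_def] U_def)
qed

theorem theorem3p14:
  fixes G :: "'a::complex_hilbert_space \<Rightarrow> 'a" and A B :: "'a opr"
  assumes "bounded_selfadjoint G"
    and "closed_opr A" and "densely_defined A"
    and "closed_opr B" and "densely_defined B"
    and "(odom B = odom A \<and> relatively_compact A (diff_opr B A)) \<or>
         (\<exists>\<mu> \<in> resolvent_set A \<inter> resolvent_set B.
            compact_map norm UNIV (\<lambda>x. resolvent A \<mu> x - resolvent B \<mu> x))"
  shows "sigma_pi_plus G A \<union> Fin ` reg_ap A = sigma_pi_plus G B \<union> Fin ` reg_ap B \<and>
    sigma_pi_minus G A \<union> Fin ` reg_ap A = sigma_pi_minus G B \<union> Fin ` reg_ap B \<and>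
    (Infty \<in> sigma_plus G A \<longleftrightarrow> Infty \<in> sigma_plus G B) \<and>
    (Infty \<in> sigma_minus G A \<longleftrightarrow> Infty \<in> sigma_minus G B) \<and>
    (Infty \<in> reg_ap_ext A \<longleftrightarrow> Infty \<in> reg_ap_ext B) \<and>
    ((\<exists>\<mu> \<in> resolvent_set A \<inter> resolvent_set B.
        compact_map norm UNIV (\<lambda>x. resolvent A \<mu> x - resolvent B \<mu> x)) \<longrightarrow>
     (\<forall>\<mu> \<in> resolvent_set A \<inter> resolvent_set B.
        compact_map norm UNIV (\<lambda>x. resolvent A \<mu> x - resolvent B \<mu> x)))"
proof -
  have A: "linear_opr A" and B: "linear_opr B"
    using assms(2,4) by (simp_all add: closed_opr_def)
  have G: "bounded_linear G"
    using assms(1) by (simp add: bounded_selfadjoint_def)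
  then have mG: "bounded_linear (\<lambda>x. - G x)"
    by (rule bounded_linear_minus)
  \<comment> \<open>Either hypothesis yields comparison maps in both directions; for resolvents the
    second comes from the negated compact difference.\<close>
  have "\<exists>T S. compactly_close T A B \<and> compactly_close S B A"
    using assms(6)
  proof
    assume "odom B = odom A \<and> relatively_compact A (diff_opr B A)"
    with relatively_compact_imp_compactly_close [OF assms(2,4)] show ?thesis by blast
  next
    assume "\<exists>\<mu> \<in> resolvent_set A \<inter> resolvent_set B.
      compact_map norm UNIV (\<lambda>x. resolvent A \<mu> x - resolvent B \<mu> x)"
    then show ?thesis
      using compact_resolvent_difference_imp_compactly_close [OF A B]
        compact_resolvent_difference_imp_compactly_close [OF B A]
        compact_resolvent_difference_commute by blast
  qed
  then obtain T S where T: "compactly_close T A B" and S: "compactly_close S B A" by blast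
  have "bounded_opr A \<longleftrightarrow> bounded_opr B"
    using compactly_close_bounded_opr T S by blast
  moreover have "\<forall>\<mu> \<in> resolvent_set A \<inter> resolvent_set B.
      compact_map norm UNIV (\<lambda>x. resolvent A \<mu> x - resolvent B \<mu> x)"
    if "\<exists>\<mu> \<in> resolvent_set A \<inter> resolvent_set B.
      compact_map norm UNIV (\<lambda>x. resolvent A \<mu> x - resolvent B \<mu> x)"
    using that compact_resolvent_difference_change_point [OF A B] by blast
  \<comment> \<open>Each equality is a pair of inclusions exchanged by swapping \<open>A\<close> and
    \<open>B\<close>; the negative type is the positive type for \<open>- G\<close>.\<close>
  ultimately show ?thesis
    unfolding sigma_minus_eq_sigma_plus Infty_in_reg_ap_ext_iff
    using sigma_plus_subset_if_compactly_close [OF T S A G]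
      sigma_plus_subset_if_compactly_close [OF S T B G]
      sigma_plus_subset_if_compactly_close [OF T S A mG]
      sigma_plus_subset_if_compactly_close [OF S T B mG]
    by (intro conjI impI subset_antisym iffI) simp_all
qed

end
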